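(* For every nonnegative integer $n$, the number of signed partitions $\sigma=(\pi,\nu)$ of $n+1$ such that (i) $\ell(\pi)$ is odd, and each positive part is odd and $\geq \ell(\pi)$, and (ii) the negative parts are odd, less than $\ell(\pi)$, and each value appears at most twice among the negative parts, equals the number of (ordinary) partitions of $n$ into parts congruent to $\pm 2, \pm 6, \pm 7, \pm 8 \pmod{18}$.
   Context: A partition $\lambda$ of length $\ell=\ell(\lambda)$ is an $\ell$-tuple $(\lambda_1,\dots,\lambda_\ell)$ of positive integers (its parts) with $\lambda_i\geq\lambda_{i+1}$ for $1\le i\le \ell-1$; its weight is $|\lambda|=\sum_i\lambda_i$, and it is a partition of $n$ if $|\lambda|=n$. The empty partition (length $0$, weight $0$) is allowed. A signed partition $\sigma$ of an integer $n$ is a pair $(\pi,\nu)$ of partitions with $n=|\pi|-|\nu|$; the parts of $\pi$ are called the positive parts of $\sigma$ and the parts of $\nu$ (which are positive integers) are called the negative parts of $\sigma$. *)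

theory Defs
  imports "HOL-Number_Theory.Cong"
begin

text \<open>A partition is the weakly decreasing list of its (positive) parts, so that \<^term>\<open>length\<close>
  is its length and \<^term>\<open>sum_list\<close> its weight. The empty list is the empty partition.\<close>

definition is_partition :: "nat list \<Rightarrow> bool" where
  "is_partition xs \<longleftrightarrow> sorted_wrt (\<ge>) xs \<and> (\<forall>x\<in>set xs. x > 0)"

definition partition_of :: "nat list \<Rightarrow> nat \<Rightarrow> bool" where
  "partition_of xs n \<longleftrightarrow> is_partition xs \<and> sum_list xs = n"

text \<open>The parts of the second component are stored as positive integers; the sign is only
  taken into account in the weight.\<close>

definition signed_partition_of :: "nat list \<times> nat list \<Rightarrow> int \<Rightarrow> bool" where
  "signed_partition_of \<sigma> n \<longleftrightarrow>
     (case \<sigma> of (\<pi>, \<nu>) \<Rightarrow> is_partition \<pi> \<and> is_partition \<nu> \<and>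
        n = int (sum_list \<pi>) - int (sum_list \<nu>))"

definition restricted_signed_partitions :: "nat \<Rightarrow> (nat list \<times> nat list) set" where
  "restricted_signed_partitions n =
     {(\<pi>, \<nu>). signed_partition_of (\<pi>, \<nu>) (int n) \<and>
        odd (length \<pi>) \<and> (\<forall>p\<in>set \<pi>. odd p \<and> p \<ge> length \<pi>) \<and>
        (\<forall>q\<in>set \<nu>. odd q \<and> q < length \<pi> \<and> count_list \<nu> q \<le> 2)}"

definition restricted_partitions :: "nat \<Rightarrow> nat list set" where
  "restricted_partitions n =
     {xs. partition_of xs n \<and>
        (\<forall>p\<in>set xs. \<exists>r\<in>{2, 6, 7, 8}. [int p = r] (mod 18) \<or> [int p = - r] (mod 18))}"

text \<open>Both sets are finite, so that \<^term>\<open>card\<close> really counts their elements.\<close>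

lemma length_mult_le_sum_list:
  assumes "\<And>x. x \<in> set xs \<Longrightarrow> k \<le> (x::nat)"
  shows "length xs * k \<le> sum_list xs"
  using assms by (induction xs) (auto simp: add_mono)

lemma finite_partitions_le: "finite {xs. is_partition xs \<and> sum_list xs \<le> n}"
proof (rule finite_subset)
  show "finite {xs. set xs \<subseteq> {..n} \<and> length xs \<le> n}"
    by (rule finite_lists_length_le) simp
  show "{xs. is_partition xs \<and> sum_list xs \<le> n} \<subseteq> {xs. set xs \<subseteq> {..n} \<and> length xs \<le> n}"
  proof safe
    fix xs assume *: "is_partition xs" "sum_list xs \<le> n"
    then show "length xs \<le> n"
      using length_mult_le_sum_list[of xs 1] by (force simp: is_partition_def)
    fix x assume "x \<in> set xs"
    then show "x \<le> n" using * member_le_sum_list[of x xs] by simp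
  qed
qed

lemma finite_restricted_partitions: "finite (restricted_partitions n)"
  by (rule finite_subset[OF _ finite_partitions_le[of n]])
     (auto simp: restricted_partitions_def partition_of_def)

lemma finite_restricted_signed_partitions: "finite (restricted_signed_partitions n)"
proof (rule finite_subset)
  let ?P = "{xs. is_partition xs \<and> sum_list xs \<le> 2 * n}"
  show "finite (?P \<times> ?P)"
    using finite_partitions_le by blast
  show "restricted_signed_partitions n \<subseteq> ?P \<times> ?P"
  proof safe
    fix p q assume A: "(p, q) \<in> restricted_signed_partitions n"
    then show "is_partition p" "is_partition q"
      by (auto simp: restricted_signed_partitions_def signed_partition_of_def)
    from A have w: "sum_list p = n + sum_list q"
      by (auto simp: restricted_signed_partitions_def signed_partition_of_def)
    from A obtain m where m: "length p = 2 * m + 1"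
      by (auto simp: restricted_signed_partitions_def elim: oddE)
    have "length p * length p \<le> sum_list p"
      using A by (intro length_mult_le_sum_list) (auto simp: restricted_signed_partitions_def)
    then have k: "4 * m * m \<le> n + sum_list q"
      using m w by simp
    have sub: "set q \<subseteq> (\<lambda>i. 2 * i + 1) ` {..<m}"
    proof
      fix x assume "x \<in> set q"
      then have "odd x" "x < 2 * m + 1"
        using A m by (auto simp: restricted_signed_partitions_def)
      then show "x \<in> (\<lambda>i. 2 * i + 1) ` {..<m}"
        by (auto elim!: oddE)
    qed
    have "sum_list q = (\<Sum>x\<in>set q. count_list q x * x)"
      using sum_list_map_eq_sum_count[of "\<lambda>x. x" q] by simp
    also have "\<dots> \<le> (\<Sum>x\<in>set q. 2 * x)"
      using A by (intro sum_mono mult_right_mono) (auto simp: restricted_signed_partitions_def)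
    also have "\<dots> \<le> (\<Sum>x\<in>(\<lambda>i. 2 * i + 1) ` {..<m}. 2 * x)"
      using sub by (intro sum_mono2) auto
    also have "\<dots> = (\<Sum>i<m. 2 * (2 * i + 1))"
      by (subst sum.reindex) (auto simp: inj_on_def)
    also have "\<dots> = 2 * m * m"
      by (induction m) (auto simp: algebra_simps)
    finally have "sum_list q \<le> n"
      using k by simp
    then show "sum_list p \<le> 2 * n" "sum_list q \<le> 2 * n"
      using w by auto
  qed
qed

end

theory Submission
  imports Defs "HOL-Complex_Analysis.Complex_Analysis"
begin

text \<open>Write $(a;q)_n = \prod_{i<n} (1 - a q^i)$. If the positive parts number $2m+1$, they have the
  generating function $q^{(2m+1)^2} / (q^2;q^2)_{2m+1}$, and the negative parts, counted with
  negative weight, have $\prod_{i<m} (1 + q^{-2i-1} + q^{-4i-2})$. After removal of one factor $q$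
  the theorem is therefore the identity of Rogers--Ramanujan type
  \[ \sum_n \frac{q^{2n^2+4n}}{(q^2;q^2)_{2n+1}} \prod_{i<n} (1 + q^{2i+1} + q^{4i+2})
     = \prod_{r} \frac{1}{(q^r;q^{18})_\infty}, \qquad r = 2, 6, 7, 8, 10, 11, 12, 16. \]

  For a primitive cube root of unity $z$ each factor of the product on the left is
  $(1 - z q^{2i+1})(1 - q^{2i+1}/z)$. The finite triple product
  expands $(zq;q^2)_{n+1} (q/z;q^2)_n / (q^2;q^2)_{2n+1}$ into powers of $z$; this has the factor
  $1 - z q^{2n+1}$ too many, but in the difference of the expansions for $z$ and $1/z$ the
  constant $1$ of this factor cancels, and a factor $q^{2n+1}$ is left. It lowers the exponent
  $2n^2+4n$ to $2n^2+2n$, and with this exponent the sum over $n$ can be carried out for each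
  power of $z$ separately (\<open>central_sum\<close>). Since $z^j - z^{-j}$ is a multiple of the nontrivial
  character $\chi$ modulo 3, this leaves the series $\sum_j \chi(j) (-1)^{j-1} q^{3j^2-2j-1}$
  (\<open>cyclotomic_series\<close>). It is a special case of the quintuple product series
  (\<open>quintuple_product\<close>), which is obtained by multiplying two triple products,
  and the resulting infinite products combine to the right-hand side (\<open>product_side\<close>).

  The infinite sums and products are taken for real $0 < q < 1$, where they converge absolutely
  and can be rearranged; the counting functions are then compared by the uniqueness of power series
  coefficients.\<close>

section \<open>The q-binomial theorem and the finite triple product\<close>

definition qpoch :: "'a::comm_ring_1 \<Rightarrow> 'a \<Rightarrow> nat \<Rightarrow> 'a" where
  "qpoch a q n = (\<Prod>i<n. 1 - a * q ^ i)"

lemma qpoch_0 [simp]: "qpoch a q 0 = 1"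
  by (simp add: qpoch_def)

lemma qpoch_Suc: "qpoch a q (Suc n) = qpoch a q n * (1 - a * q ^ n)"
  by (simp add: qpoch_def)

lemma qpoch_dissect:
  "qpoch a q (n * m) = (\<Prod>r<m. qpoch (a * q ^ r) (q ^ m) n)"
proof -
  have "qpoch a q (n * m) = (\<Prod>k<n. \<Prod>i\<in>{k * m..<k * m + m}. 1 - a * q ^ i)"
    unfolding qpoch_def by (rule prod.nat_group [symmetric])
  also have "\<dots> = (\<Prod>k<n. \<Prod>r<m. 1 - a * q ^ (r + k * m))"
  proof (rule prod.cong [OF refl])
    fix k
    show "(\<Prod>i\<in>{k * m..<k * m + m}. 1 - a * q ^ i) = (\<Prod>r<m. 1 - a * q ^ (r + k * m))"
      by (rule prod.reindex_bij_witness[of _ "\<lambda>r. r + k * m" "\<lambda>i. i - k * m"]) auto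
  qed
  also have "\<dots> = (\<Prod>r<m. \<Prod>k<n. 1 - a * q ^ (r + k * m))"
    by (rule prod.swap)
  also have "\<dots> = (\<Prod>r<m. qpoch (a * q ^ r) (q ^ m) n)"
    by (simp add: qpoch_def power_add mult.assoc mult.commute[of _ m] flip: power_mult)
  finally show ?thesis .
qed

lemma qpoch_mult_neg: "qpoch a q n * qpoch (- a) q n = qpoch (a\<^sup>2) (q\<^sup>2) n"
  unfolding qpoch_def prod.distrib [symmetric]
  by (intro prod.cong refl) (simp add: power2_eq_square algebra_simps power_mult_distrib)

text \<open>The coefficients, multiplied by $(q;q)_N$, are the q-binomial coefficients with the usual
  signs and powers of q. Dividing by $(q;q)_N$ instead keeps both factors of the denominator
  visible, which is what the limits below need; the induction step is the q-Pascal rule.\<close>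

lemma q_binomial_theorem:
  fixes q :: "'a::field"
  assumes nz: "\<And>k. qpoch q q k \<noteq> 0"
  shows "qpoch y q N / qpoch q q N =
    (\<Sum>k\<le>N. (- y) ^ k * q ^ (k * (k - 1) div 2) / (qpoch q q k * qpoch q q (N - k)))"
proof (induction N)
  case (Suc N)
  define t where "t = (\<lambda>k. (- y) ^ k * q ^ (k * (k - 1) div 2))"
  have t_Suc: "t (Suc k) = - y * q ^ k * t k" for k
  proof -
    have "Suc k * (Suc k - 1) div 2 = k + k * (k - 1) div 2"
    proof -
      have "even (k * (k - 1))" by (cases k) auto
      then have "Suc k * (Suc k - 1) div 2 = (2 * k + k * (k - 1)) div 2"
        by (cases k) (auto simp: algebra_simps)
      then show ?thesis by simp
    qed
    then show ?thesis by (simp add: t_def power_add)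
  qed
  have nz': "1 - q ^ Suc k \<noteq> 0" for k
    using nz[of "Suc k"] by (auto simp: qpoch_Suc)
  define c where "c = (\<lambda>k. t k / (qpoch q q k * qpoch q q (N - k)))"
  \<comment> \<open>The two terms of the q-Pascal rule, with the value 0 at the respective end of the range.\<close>
  define a where "a = (\<lambda>k. if k \<le> N then c k else 0)"
  define b where "b = (\<lambda>k. if k = 0 then 0 else - y * q ^ N * c (k - 1))"
  have split: "(1 - q ^ Suc N) * (t k / (qpoch q q k * qpoch q q (Suc N - k))) = a k + b k"
    if kN: "k \<le> Suc N" for k
  proof -
    consider "k = 0" | "k = Suc N" | j d where "k = Suc j" "N = Suc (j + d)"
    proof (cases "k = 0 \<or> k = Suc N")
      case False
      with kN have "k = Suc (k - 1)" "N = Suc ((k - 1) + (N - k))" by auto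
      then show ?thesis by (rule that(3))
    qed (use that in auto)
    then show ?thesis
    proof cases
      case 1
      then show ?thesis
        using nz[of N] nz'[of N] by (simp add: a_def b_def c_def t_def qpoch_Suc field_simps)
    next
      case 2
      then show ?thesis
        using nz[of N] nz'[of N] by (simp add: a_def b_def c_def t_Suc qpoch_Suc field_simps)
    next
      case (3 j d)
      have D: "Suc N - k = Suc d" "N - k = d" "N - (k - 1) = Suc d"
        using 3 by auto
      have e: "q ^ Suc N = q ^ Suc j * q ^ Suc d" "q ^ N = q ^ j * q ^ Suc d"
        using 3 by (simp_all flip: power_add)
      have "a k = t k / (qpoch q q k * qpoch q q d)"
        using 3 D by (simp add: a_def c_def)
      also have "\<dots> = (1 - q ^ Suc d) * t k / (qpoch q q k * qpoch q q (Suc d))"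
        using nz[of d] nz'[of d] by (simp add: qpoch_Suc)
      finally have A: "a k = \<dots>" .
      have "b k = - y * q ^ N * t j / (qpoch q q j * qpoch q q (Suc d))"
        using 3 D by (simp add: b_def c_def)
      also have "\<dots> = (1 - q ^ Suc j) * q ^ Suc d * t k / (qpoch q q k * qpoch q q (Suc d))"
        using nz[of j] nz'[of j] 3(1) by (simp add: e(2) t_Suc qpoch_Suc)
      finally have B: "b k = \<dots>" .
      show ?thesis
        unfolding A B D e by (simp add: add_divide_distrib [symmetric] algebra_simps)
    qed
  qed
  have "(1 - q ^ Suc N) * (\<Sum>k\<le>Suc N. t k / (qpoch q q k * qpoch q q (Suc N - k))) =
      (\<Sum>k\<le>Suc N. a k) + (\<Sum>k\<le>Suc N. b k)"
    unfolding sum_distrib_left sum.distrib [symmetric] by (intro sum.cong refl split) auto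
  also have "(\<Sum>k\<le>Suc N. a k) = (\<Sum>k\<le>N. c k)"
    by (simp add: a_def)
  also have "(\<Sum>k\<le>Suc N. b k) = - y * q ^ N * (\<Sum>k\<le>N. c k)"
    by (subst sum.atMost_Suc_shift) (simp add: b_def sum_distrib_left)
  also have "(\<Sum>k\<le>N. c k) = qpoch y q N / qpoch q q N"
    using Suc.IH by (simp add: c_def t_def)
  finally have "(1 - q ^ Suc N) * (\<Sum>k\<le>Suc N. t k / (qpoch q q k * qpoch q q (Suc N - k))) =
      qpoch y q (Suc N) / qpoch q q N"
    by (simp add: qpoch_Suc algebra_simps diff_divide_distrib)
  then have "(\<Sum>k\<le>Suc N. t k / (qpoch q q k * qpoch q q (Suc N - k))) =
      qpoch y q (Suc N) / qpoch q q N / (1 - q ^ Suc N)"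
    using nz'[of N] by (metis nonzero_mult_div_cancel_left)
  then show ?case
    unfolding t_def by (simp add: qpoch_Suc [of q q])
qed (simp)

text \<open>The value 0 at negative arguments is the usual convention $1/(q;q)_k = 0$ for $k < 0$. With it
  the finite sums below become sums over all integers, with natural boundaries.\<close>

definition qfact_inv :: "'a::field \<Rightarrow> int \<Rightarrow> 'a" where
  "qfact_inv q k = (if k < 0 then 0 else 1 / qpoch q q (nat k))"

text \<open>This is the q-binomial coefficient of $2n+1$ over $n+j$, divided by $(q;q)_{2n+1}$.\<close>

definition central :: "'a::field \<Rightarrow> nat \<Rightarrow> int \<Rightarrow> 'a" where
  "central q n j = qfact_inv q (int n + j) * qfact_inv q (int n + 1 - j)"

lemma central_eq_0: "j \<notin> {- int n..int n + 1} \<Longrightarrow> central q n j = 0"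
  by (auto simp: central_def qfact_inv_def)

text \<open>The q-binomial theorem in base $q^2$ with $2n+1$ factors, whose argument is chosen such that
  the first $n$ factors are, up to monomials, those of $(q/z;q^2)_n$ in reverse order. The monomial
  factor \<open>?P\<close> collects what is taken out of them.\<close>

lemma finite_jacobi_triple_product:
  fixes q z :: "'a::field"
  assumes q: "q \<noteq> 0" and z: "z \<noteq> 0" and nz: "\<And>k. qpoch (q\<^sup>2) (q\<^sup>2) k \<noteq> 0"
  shows "qpoch (z * q) (q\<^sup>2) (Suc n) * qpoch (q / z) (q\<^sup>2) n / qpoch (q\<^sup>2) (q\<^sup>2) (2 * n + 1) =
    (\<Sum>j\<in>{- int n..int n + 1}. (- z) powi j * q powi (j\<^sup>2) * central (q\<^sup>2) n j)"
proof -
  let ?y = "z * q powi (1 - 2 * int n)"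
  let ?P = "(- z) ^ n * q powi (- (int n)\<^sup>2)"
  have split: "(\<Prod>i<k + m. f i) = (\<Prod>i<k. f i) * (\<Prod>i<m. f (k + i))" for k m and f :: "nat \<Rightarrow> 'a"
    by (induction m) (simp_all add: mult.assoc)
  have pw: "(q\<^sup>2) ^ i = q powi (2 * int i)" for i
    by (simp add: power_int_mult)
  have "qpoch ?y (q\<^sup>2) (2 * n + 1) = (\<Prod>i<2 * n + 1. 1 - z * q powi (1 - 2 * int n + 2 * int i))"
    unfolding qpoch_def using q
    by (intro prod.cong refl) (simp add: pw power_int_add mult.assoc)
  also have "\<dots> = (\<Prod>i<n. 1 - z * q powi (1 - 2 * int n + 2 * int i)) *
      (\<Prod>i<Suc n. 1 - z * q powi (1 + 2 * int i))"
    using split[of "\<lambda>i. 1 - z * q powi (1 - 2 * int n + 2 * int i)" n "Suc n"]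
    by (simp only: mult_2 add.assoc Suc_eq_plus1) (simp add: algebra_simps)
  also have "(\<Prod>i<Suc n. 1 - z * q powi (1 + 2 * int i)) = qpoch (z * q) (q\<^sup>2) (Suc n)"
    unfolding qpoch_def using q
    by (intro prod.cong refl) (simp add: pw power_int_add mult.assoc)
  also have "(\<Prod>i<n. 1 - z * q powi (1 - 2 * int n + 2 * int i)) = ?P * qpoch (q / z) (q\<^sup>2) n"
  proof (induction n)
    case (Suc n)
    have e: "q powi (- (int (Suc n))\<^sup>2) = q powi (- (int n)\<^sup>2) * q powi (- 1 - 2 * int n)"
      using q by (simp add: power_int_add [symmetric]) (simp add: power2_eq_square algebra_simps)
    have "(\<Prod>i<Suc n. 1 - z * q powi (1 - 2 * int (Suc n) + 2 * int i)) =
       (1 - z * q powi (- 1 - 2 * int n)) * (\<Prod>i<n. 1 - z * q powi (1 - 2 * int n + 2 * int i))"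
      by (subst prod.lessThan_Suc_shift) (simp add: algebra_simps)
    also note Suc.IH
    also have "1 - z * q powi (- 1 - 2 * int n) = - z * q powi (- 1 - 2 * int n) * (1 - q / z * (q\<^sup>2) ^ n)"
      using q z by (simp add: power_int_diff field_simps power_int_minus power_int_mult power_int_of_nat flip: power_mult)
    also have "- z * q powi (- 1 - 2 * int n) * (1 - q / z * (q\<^sup>2) ^ n) *
        ((- z) ^ n * q powi (- (int n)\<^sup>2) * qpoch (q / z) (q\<^sup>2) n) =
      (- z) ^ Suc n * q powi (- (int (Suc n))\<^sup>2) * qpoch (q / z) (q\<^sup>2) (Suc n)"
      unfolding e qpoch_Suc power_Suc by (simp only: mult_ac)
    finally show ?case .
  qed simp
  finally have L: "qpoch ?y (q\<^sup>2) (2 * n + 1) =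
    ?P * (qpoch (z * q) (q\<^sup>2) (Suc n) * qpoch (q / z) (q\<^sup>2) n)"
    by (simp add: mult_ac)
  have P: "?P \<noteq> 0" using q z by simp
  have "qpoch ?y (q\<^sup>2) (2 * n + 1) / qpoch (q\<^sup>2) (q\<^sup>2) (2 * n + 1) =
    (\<Sum>k\<le>2 * n + 1. (- ?y) ^ k * (q\<^sup>2) ^ (k * (k - 1) div 2) /
       (qpoch (q\<^sup>2) (q\<^sup>2) k * qpoch (q\<^sup>2) (q\<^sup>2) (2 * n + 1 - k)))"
    by (rule q_binomial_theorem [OF nz])
  also have "\<dots> = (\<Sum>j\<in>{- int n..int n + 1}. ?P * ((- z) powi j * q powi (j\<^sup>2) * central (q\<^sup>2) n j))"
  proof (rule sum.reindex_bij_witness [of _ "\<lambda>j. nat (int n + j)" "\<lambda>k. int k - int n"]; clarsimp?)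
    fix k assume k: "k \<le> Suc (2 * n)"
    have e: "int (2 * (k * (k - 1) div 2)) = int k * (int k - 1)"
      by (cases k) (auto simp: algebra_simps)
    have "(q\<^sup>2) ^ (k * (k - 1) div 2) = q powi (int k * (int k - 1))"
      unfolding e [symmetric] power_int_of_nat power_mult [symmetric] ..
    moreover have "(- ?y) ^ k = (- z) ^ k * q powi ((1 - 2 * int n) * int k)"
      by (simp add: power_int_mult power_int_of_nat flip: power_mult_distrib)
    moreover have "(- z) ^ k = (- z) ^ n * (- z) powi (int k - int n)"
      using z by (simp add: power_int_diff power_int_of_nat)
    moreover have "q powi ((1 - 2 * int n) * int k) * q powi (int k * (int k - 1)) =
       q powi (- (int n)\<^sup>2) * q powi ((int k - int n)\<^sup>2)"
      using q by (simp add: power_int_add [symmetric] power2_eq_square algebra_simps)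
    moreover have "central (q\<^sup>2) n (int k - int n) =
        1 / (qpoch (q\<^sup>2) (q\<^sup>2) k * qpoch (q\<^sup>2) (q\<^sup>2) (Suc (2 * n) - k))"
    proof -
      have i: "int n + (int k - int n) = int k" "int n + 1 - (int k - int n) = int (Suc (2 * n) - k)"
        using k by auto
      show ?thesis unfolding central_def i qfact_inv_def by simp
    qed
    ultimately show "?P * ((- z) powi (int k - int n) * q powi (int k - int n)\<^sup>2 * central (q\<^sup>2) n (int k - int n)) =
      (- ?y) ^ k * (q\<^sup>2) ^ (k * (k - Suc 0) div 2) /
       (qpoch (q\<^sup>2) (q\<^sup>2) k * qpoch (q\<^sup>2) (q\<^sup>2) (Suc (2 * n) - k))"
      by (simp only: mult_ac One_nat_def) (simp add: mult_ac)
  qed auto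
  finally show ?thesis
    unfolding L sum_distrib_left [symmetric] times_divide_eq_right [symmetric] mult_left_cancel [OF P] .
qed

section \<open>Specialization at a cube root of unity\<close>

text \<open>The nontrivial Dirichlet character modulo 3.\<close>

definition chi3 :: "int \<Rightarrow> 'a::ring_1" where
  "chi3 k = (if 3 dvd k then 0 else if k mod 3 = 1 then 1 else - 1)"

lemma of_real_chi3 [simp]: "of_real (chi3 k) = chi3 k"
  by (simp add: chi3_def)

lemma powi_diff_eq_chi3:
  fixes z :: "'a::field"
  assumes z: "1 + z + z\<^sup>2 = 0"
  shows "z powi k - z powi (- k) = chi3 k * (z - 1 / z)"
proof -
  have z0: "z \<noteq> 0" using z by auto
  have "z ^ 3 - 1 = (z - 1) * (1 + z + z\<^sup>2)"
    by (simp add: power2_eq_square power3_eq_cube algebra_simps)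
  then have z3: "z ^ 3 = 1" using z by simp
  then have z2: "z\<^sup>2 = 1 / z"
    using z0 by (simp add: field_simps power3_eq_cube power2_eq_square)
  have "z powi (3 * (k div 3)) = 1"
    using z3 power_int_mult [of z 3 "k div 3"] by simp
  then have k: "z powi k = z powi (k mod 3)"
    using power_int_add [of z "3 * (k div 3)" "k mod 3"] z0 by simp
  have "k mod 3 = 0 \<or> k mod 3 = 1 \<or> k mod 3 = 2" by presburger
  then show ?thesis
  proof (elim disjE)
    assume "k mod 3 = 2"
    then show ?thesis by (simp add: power_int_minus k z2 chi3_def dvd_eq_mod_eq_0)
  qed (auto simp: power_int_minus k chi3_def dvd_eq_mod_eq_0 field_simps)
qed

text \<open>The triple product has one factor more than the product on the left. Written for $z$ and for
  $1/z$, this factor is $1 - z x$ and $1 - x/z$ with $x = q^{2n+1}$. The difference of the two is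
  $-(z - 1/z) x$, so that the extra factor turns into the power of $q$ on the left.\<close>

lemma cyclotomic_sum_general:
  fixes q z :: "'a::field"
  assumes q: "q \<noteq> 0" and nz: "\<And>k. qpoch (q\<^sup>2) (q\<^sup>2) k \<noteq> 0"
    and z: "1 + z + z\<^sup>2 = 0" and z': "z - 1 / z \<noteq> 0"
  shows "q ^ (2 * n + 1) * (\<Prod>i<n. 1 + q ^ (2 * i + 1) + q ^ (4 * i + 2)) / qpoch (q\<^sup>2) (q\<^sup>2) (2 * n + 1) =
    - (\<Sum>j\<in>{- int n..int n + 1}. (- 1) powi j * chi3 j * q powi (j\<^sup>2) * central (q\<^sup>2) n j)"
proof -
  have z0: "z \<noteq> 0" using z by auto
  let ?J = "{- int n..int n + 1}" and ?D = "qpoch (q\<^sup>2) (q\<^sup>2) (2 * n + 1)"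
  let ?T = "\<Prod>i<n. 1 + q ^ (2 * i + 1) + q ^ (4 * i + 2)"
  have T: "qpoch (z * q) (q\<^sup>2) n * qpoch (q / z) (q\<^sup>2) n = ?T"
    unfolding qpoch_def prod.distrib [symmetric]
  proof (rule prod.cong [OF refl])
    fix i
    have s: "z + 1 / z = - 1"
      using z z0 by (simp add: eq_neg_iff_add_eq_0 field_simps power2_eq_square)
    define x where "x = q ^ (2 * i + 1)"
    have "x = q * (q\<^sup>2) ^ i"
      by (simp add: x_def power_mult)
    then have "(1 - z * q * (q\<^sup>2) ^ i) * (1 - q / z * (q\<^sup>2) ^ i) = (1 - z * x) * (1 - x / z)"
      by (simp add: mult_ac)
    also have "\<dots> = 1 - (z + 1 / z) * x + x\<^sup>2"
      using z0 by (simp add: field_simps power2_eq_square)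
    also have "x\<^sup>2 = q ^ (4 * i + 2)"
      unfolding x_def power_mult [symmetric] by (rule arg_cong [of _ _ "power q"]) simp
    finally show "(1 - z * q * (q\<^sup>2) ^ i) * (1 - q / z * (q\<^sup>2) ^ i) = 1 + q ^ (2 * i + 1) + q ^ (4 * i + 2)"
      by (simp add: s x_def)
  qed
  have T': "qpoch (1 / z * q) (q\<^sup>2) n * qpoch (q / (1 / z)) (q\<^sup>2) n = ?T"
    using T by (simp add: mult.commute)
  have x: "q * (q\<^sup>2) ^ n = q ^ (2 * n + 1)"
    by (simp add: power_mult)
  have S: "qpoch (w * q) (q\<^sup>2) (Suc n) * r = (1 - w * q ^ (2 * n + 1)) * (qpoch (w * q) (q\<^sup>2) n * r)" for w r
    unfolding qpoch_Suc mult.assoc x by (simp only: mult_ac)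
  have A: "(1 - z * q ^ (2 * n + 1)) * ?T / ?D =
     (\<Sum>j\<in>?J. (- z) powi j * q powi (j\<^sup>2) * central (q\<^sup>2) n j)"
    using finite_jacobi_triple_product [OF q z0 nz, of n] unfolding S T .
  have B: "(1 - 1 / z * q ^ (2 * n + 1)) * ?T / ?D =
     (\<Sum>j\<in>?J. (- (1 / z)) powi j * q powi (j\<^sup>2) * central (q\<^sup>2) n j)"
    using finite_jacobi_triple_product [OF q _ nz, of "1 / z" n] z0 unfolding S T' by simp
  have "(- (z - 1 / z)) * (q ^ (2 * n + 1) * ?T / ?D) =
      (1 - z * q ^ (2 * n + 1)) * ?T / ?D - (1 - 1 / z * q ^ (2 * n + 1)) * ?T / ?D"
    by (simp add: algebra_simps diff_divide_distrib)
  also have "\<dots> = (\<Sum>j\<in>?J. ((- z) powi j - (- (1 / z)) powi j) * q powi (j\<^sup>2) * central (q\<^sup>2) n j)"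
    unfolding A B by (simp add: sum_subtractf algebra_simps)
  also have "\<dots> = (z - 1 / z) * (\<Sum>j\<in>?J. (- 1) powi j * chi3 j * q powi (j\<^sup>2) * central (q\<^sup>2) n j)"
    unfolding sum_distrib_left
  proof (rule sum.cong [OF refl])
    fix j
    have "(- z) powi j = (- 1) powi j * z powi j"
      using power_int_mult_distrib [of "- 1" z j] by simp
    moreover have "(- (1 / z)) powi j = (- 1) powi j * z powi (- j)"
      using power_int_mult_distrib [of "- 1" "1 / z" j]
      by (simp add: power_int_minus power_int_divide_distrib field_simps)
    ultimately have "(- z) powi j - (- (1 / z)) powi j = (- 1) powi j * (chi3 j * (z - 1 / z))"
      unfolding powi_diff_eq_chi3 [OF z, symmetric] by (simp add: algebra_simps)
    then show "((- z) powi j - (- (1 / z)) powi j) * q powi (j\<^sup>2) * central (q\<^sup>2) n j =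
      (z - 1 / z) * ((- 1) powi j * chi3 j * q powi (j\<^sup>2) * central (q\<^sup>2) n j)"
      by simp
  qed
  finally have "- (z - 1 / z) * (q ^ (2 * n + 1) * ?T / ?D) = - (z - 1 / z) *
     (- (\<Sum>j\<in>?J. (- 1) powi j * chi3 j * q powi (j\<^sup>2) * central (q\<^sup>2) n j))"
    by (simp only: minus_mult_minus)
  moreover have n0: "- (z - 1 / z) \<noteq> 0"
    using z' by simp
  ultimately show ?thesis
    unfolding mult_left_cancel [OF n0] by simp
qed

lemma of_real_qpoch: "of_real (qpoch a q n) = qpoch (of_real a) (of_real q) n"
  by (simp add: qpoch_def)

lemma of_real_central: "complex_of_real (central q n j) = central (of_real q) n j"
  by (simp add: central_def qfact_inv_def of_real_qpoch)

text \<open>Both sides are real for real $q$, but the root of unity that proves the identity is not.\<close>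

lemma cyclotomic_sum:
  fixes q :: real
  assumes q: "q \<noteq> 0" and nz: "\<And>k. qpoch (q\<^sup>2) (q\<^sup>2) k \<noteq> 0"
  shows "q ^ (2 * n + 1) * (\<Prod>i<n. 1 + q ^ (2 * i + 1) + q ^ (4 * i + 2)) / qpoch (q\<^sup>2) (q\<^sup>2) (2 * n + 1) =
    - (\<Sum>j\<in>{- int n..int n + 1}. (- 1) powi j * chi3 j * q powi (j\<^sup>2) * central (q\<^sup>2) n j)"
    (is "?L = ?R")
proof -
  define z where "z = Complex (- 1 / 2) (sqrt 3 / 2)"
  have z: "1 + z + z\<^sup>2 = 0"
    by (simp add: z_def complex_eq_iff power2_eq_square)
  have z': "z - 1 / z \<noteq> 0"
  proof
    assume "z - 1 / z = 0"
    moreover have "z \<noteq> 0" by (simp add: z_def complex_eq_iff)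
    ultimately have "z\<^sup>2 = 1" by (simp add: field_simps power2_eq_square)
    then show False by (simp add: z_def complex_eq_iff power2_eq_square)
  qed
  let ?q = "complex_of_real q"
  have nz': "qpoch (?q\<^sup>2) (?q\<^sup>2) k \<noteq> 0" for k
    using nz [of k] by (simp flip: of_real_power of_real_qpoch)
  have q': "?q \<noteq> 0" using q by simp
  have "complex_of_real ?L = complex_of_real ?R"
    unfolding of_real_mult of_real_divide of_real_power of_real_prod of_real_add of_real_1
      of_real_minus of_real_sum of_real_qpoch of_real_central of_real_power_int of_real_chi3
    using cyclotomic_sum_general [OF q' nz' z z', of n] .
  then show ?thesis
    unfolding of_real_eq_iff .
qed

section \<open>Summation over arbitrary index sets\<close>

text \<open>Tannery's theorem (dominated convergence for sums), for the unordered summation that is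
  convenient for sums over the integers and over sets of partitions.\<close>

lemma tannery_has_sum:
  fixes f :: "nat \<Rightarrow> 'b \<Rightarrow> 'c::banach"
  assumes lim: "\<And>x. x \<in> A \<Longrightarrow> (\<lambda>n. f n x) \<longlonglongrightarrow> g x"
    and bound: "\<And>n x. x \<in> A \<Longrightarrow> norm (f n x) \<le> M x" and M: "M summable_on A"
    and sums: "\<And>n. (f n has_sum S n) A" and S: "S \<longlonglongrightarrow> L"
  shows "(g has_sum L) A"
proof -
  have "norm (g x) \<le> M x" if "x \<in> A" for x
    using bound [OF that] by (intro Lim_norm_ubound [OF _ lim [OF that]]) auto
  then have g: "g summable_on A"
    by (rule abs_summable_summable [OF Infinite_Sum.abs_summable_on_comparison_test' [OF M]])
  have "S \<longlonglongrightarrow> infsum g A"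
  proof (rule swap_uniform_limit')
    show "\<forall>\<^sub>F X in finite_subsets_at_top A. (\<lambda>n. \<Sum>x\<in>X. f n x) \<longlonglongrightarrow> sum g X"
      by (intro eventually_finite_subsets_at_top_weakI tendsto_sum lim) auto
    show "(sum g \<longlongrightarrow> infsum g A) (finite_subsets_at_top A)"
      using g by (simp add: infsum_tendsto)
    show "uniform_limit UNIV (\<lambda>X n. \<Sum>x\<in>X. f n x) S (finite_subsets_at_top A)"
      by (rule Weierstrass_m_test_general' [OF bound sums M])
  qed auto
  with S have "L = infsum g A" by (rule LIMSEQ_unique)
  with g show ?thesis by simp
qed

lemma has_sum_product_real:
  fixes f :: "'a \<Rightarrow> real" and g :: "'b \<Rightarrow> real"
  assumes f: "(f has_sum a) A" and g: "(g has_sum b) B"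
  shows "((\<lambda>(x, y). f x * g y) has_sum a * b) (A \<times> B)"
proof (rule has_sum_SigmaI)
  show "((\<lambda>y. case (x, y) of (x, y) \<Rightarrow> f x * g y) has_sum f x * b) B" for x
    using has_sum_cmult_right [OF g] by simp
  show "((\<lambda>x. f x * b) has_sum a * b) A"
    by (rule has_sum_cmult_left [OF f])
  have "(\<lambda>x. \<bar>f x\<bar>) summable_on A" "(\<lambda>x. \<bar>g x\<bar>) summable_on B"
    using f [THEN has_sum_imp_summable] g [THEN has_sum_imp_summable]
    by (simp_all add: summable_on_iff_abs_summable_on_real [of f] summable_on_iff_abs_summable_on_real [of g])
  then have "(\<lambda>(x, y). \<bar>f x\<bar> * \<bar>g y\<bar>) summable_on A \<times> B"
    by (intro summable_on_SigmaI [where g = "\<lambda>x. \<bar>f x\<bar> * infsum (\<lambda>y. \<bar>g y\<bar>) B"])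
       (auto intro!: has_sum_cmult_right summable_on_cmult_left)
  then show "(\<lambda>(x, y). f x * g y) summable_on A \<times> B"
    by (subst summable_on_iff_abs_summable_on_real) (simp add: case_prod_unfold abs_mult)
qed

section \<open>Infinite products and the triple product\<close>

definition qpoch_inf :: "real \<Rightarrow> real \<Rightarrow> real" where
  "qpoch_inf a q = (\<Prod>i. 1 - a * q ^ i)"

lemma convergent_prod_qpoch:
  assumes "\<bar>q\<bar> < 1"
  shows "convergent_prod (\<lambda>i. 1 - a * q ^ i :: real)"
proof (rule abs_convergent_prod_imp_convergent_prod, rule summable_imp_abs_convergent_prod)
  show "summable (\<lambda>i. norm (1 - a * q ^ i - 1))"
    using assms by (simp add: abs_mult power_abs)
qed

lemma qpoch_tendsto:
  assumes "\<bar>q\<bar> < 1"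
  shows "qpoch a q \<longlonglongrightarrow> qpoch_inf a q"
proof -
  have "(\<lambda>n. qpoch a q (Suc n)) \<longlonglongrightarrow> qpoch_inf a q"
    using convergent_prod_LIMSEQ [OF convergent_prod_qpoch [OF assms, of a]]
    by (simp only: qpoch_inf_def qpoch_def lessThan_Suc_atMost)
  then show ?thesis by (subst (asm) filterlim_sequentially_Suc)
qed

text \<open>An infinite product that converges in the strict sense vanishes only if a factor does.\<close>

lemma qpoch_inf_eq_0_iff:
  assumes "\<bar>q\<bar> < 1"
  shows "qpoch_inf a q = 0 \<longleftrightarrow> (\<exists>i. a * q ^ i = 1)"
proof -
  have "(\<lambda>i. 1 - a * q ^ i) has_prod qpoch_inf a q"
    unfolding qpoch_inf_def using convergent_prod_has_prod [OF convergent_prod_qpoch [OF assms]] .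
  from has_prod_eq_0_iff [OF this] show ?thesis by auto
qed

lemma qpoch_inf_dissect:
  assumes "\<bar>q\<bar> < 1" "0 < m"
  shows "qpoch_inf a q = (\<Prod>r<m. qpoch_inf (a * q ^ r) (q ^ m))"
proof (rule LIMSEQ_unique)
  have m: "\<bar>q ^ m\<bar> < 1"
    using assms by (simp add: power_abs power_less_one_iff)
  have "filterlim (\<lambda>n. n * m) sequentially sequentially"
    using assms by real_asymp
  from filterlim_compose [OF qpoch_tendsto [OF assms(1)] this]
  show "(\<lambda>n. qpoch a q (n * m)) \<longlonglongrightarrow> qpoch_inf a q" .
  show "(\<lambda>n. qpoch a q (n * m)) \<longlonglongrightarrow> (\<Prod>r<m. qpoch_inf (a * q ^ r) (q ^ m))"
    unfolding qpoch_dissect by (intro tendsto_prod qpoch_tendsto m)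
qed

lemma qpoch_inf_mult_neg:
  assumes "\<bar>q\<bar> < 1"
  shows "qpoch_inf a q * qpoch_inf (- a) q = qpoch_inf (a\<^sup>2) (q\<^sup>2)"
proof (rule LIMSEQ_unique)
  have q2: "\<bar>q\<^sup>2\<bar> < 1"
    using assms abs_square_less_1 by auto
  show "(\<lambda>n. qpoch (a\<^sup>2) (q\<^sup>2) n) \<longlonglongrightarrow> qpoch_inf (a\<^sup>2) (q\<^sup>2)"
    by (rule qpoch_tendsto [OF q2])
  show "(\<lambda>n. qpoch (a\<^sup>2) (q\<^sup>2) n) \<longlonglongrightarrow> qpoch_inf a q * qpoch_inf (- a) q"
    unfolding qpoch_mult_neg [symmetric] by (intro tendsto_mult qpoch_tendsto assms)
qed

context
  fixes q :: real
  assumes q: "0 < q" "q < 1"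
begin

lemma qfact_inf_pos: "0 < qpoch_inf q q"
  and qfact_inf_le: "qpoch_inf q q \<le> qpoch q q n"
  and qfact_pos: "0 < qpoch q q n"
proof -
  have pos: "0 < 1 - q * q ^ i" for i
    using q power_less_one_iff [of q "Suc i"] by simp
  then have qpos: "0 < qpoch q q n" for n
    unfolding qpoch_def by (intro prod_pos) auto
  then show "0 < qpoch q q n" .
  have lim: "qpoch q q \<longlonglongrightarrow> qpoch_inf q q"
    using q by (intro qpoch_tendsto) auto
  have "decseq (qpoch q q)"
  proof (rule decseq_SucI)
    fix n
    have "qpoch q q n * (1 - q * q ^ n) \<le> qpoch q q n * 1"
      using q qpos [of n] by (intro mult_left_mono) auto
    then show "qpoch q q (Suc n) \<le> qpoch q q n"
      by (simp add: qpoch_Suc)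
  qed
  then show "qpoch_inf q q \<le> qpoch q q n"
    by (rule decseq_ge [OF _ lim])
  have "qpoch_inf q q \<noteq> 0"
    using q pos by (subst qpoch_inf_eq_0_iff) (auto simp: less_le)
  moreover have "0 \<le> qpoch_inf q q"
    using qpos by (intro LIMSEQ_le_const [OF lim] exI [of _ 0]) (auto intro: less_imp_le)
  ultimately show "0 < qpoch_inf q q" by simp
qed

lemma qfact_inv_bounds: "0 \<le> qfact_inv q k" "qfact_inv q k \<le> 1 / qpoch_inf q q"
  using qfact_inf_pos qfact_inf_le qfact_pos by (auto simp: qfact_inv_def less_imp_le frac_le)

lemma abs_central_le: "\<bar>central q n j\<bar> \<le> (1 / qpoch_inf q q)\<^sup>2"
  unfolding central_def abs_mult power2_eq_square using qfact_inv_bounds qfact_inf_pos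
  by (intro mult_mono) (auto simp: less_imp_le)

lemma qfact_inv_tendsto:
  assumes "filterlim k at_top sequentially"
  shows "(\<lambda>n. qfact_inv q (k n)) \<longlonglongrightarrow> 1 / qpoch_inf q q"
proof -
  have "filterlim (\<lambda>n. nat (k n)) sequentially sequentially"
    using assms filterlim_nat_sequentially filterlim_compose by blast
  then have "(\<lambda>n. qpoch q q (nat (k n))) \<longlonglongrightarrow> qpoch_inf q q"
    using q by (intro filterlim_compose [OF qpoch_tendsto]) auto
  then have "(\<lambda>n. 1 / qpoch q q (nat (k n))) \<longlonglongrightarrow> 1 / qpoch_inf q q"
    using qfact_inf_pos by (intro tendsto_intros) auto
  moreover have "eventually (\<lambda>n. 0 \<le> k n) sequentially"
    using assms by (simp add: filterlim_at_top)
  then have "eventually (\<lambda>n. 1 / qpoch q q (nat (k n)) = qfact_inv q (k n)) sequentially"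
    by eventually_elim (simp add: qfact_inv_def)
  ultimately show ?thesis
    by (rule Lim_transform_eventually)
qed

lemma central_tendsto: "(\<lambda>n. central q n j) \<longlonglongrightarrow> (1 / qpoch_inf q q)\<^sup>2"
proof -
  have "filterlim (\<lambda>n. int n + j) at_top sequentially" "filterlim (\<lambda>n. int n + 1 - j) at_top sequentially"
    by real_asymp+
  then show ?thesis
    unfolding central_def power2_eq_square by (intro tendsto_mult qfact_inv_tendsto)
qed

text \<open>On the half line of nonnegative indices the n-th term is $(z q^n)^n$, which is eventually below
  $2^{-n}$; the other half line is the same with $1/z$ for $z$.\<close>

lemma summable_theta:
  assumes "z \<noteq> 0"
  shows "(\<lambda>j. \<bar>z powi j * q powi (j\<^sup>2)\<bar>) summable_on UNIV"
proof -
  have half: "(\<lambda>j. \<bar>w powi j * q powi (j\<^sup>2)\<bar>) summable_on range int" for w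
  proof (subst summable_on_reindex)
    have "summable (\<lambda>n. \<bar>w\<bar> ^ n * q ^ (n * n))"
    proof (rule summable_comparison_test_ev)
      have "(\<lambda>n. \<bar>w\<bar> * q ^ n) \<longlonglongrightarrow> \<bar>w\<bar> * 0"
        using q by (intro tendsto_intros LIMSEQ_realpow_zero) auto
      then have "eventually (\<lambda>n. \<bar>w\<bar> * q ^ n < 1 / 2) sequentially"
        by (rule order_tendstoD(2)) simp
      then show "eventually (\<lambda>n. norm (\<bar>w\<bar> ^ n * q ^ (n * n)) \<le> (1 / 2) ^ n) sequentially"
      proof eventually_elim
        case (elim n)
        have "norm (\<bar>w\<bar> ^ n * q ^ (n * n)) = (\<bar>w\<bar> * q ^ n) ^ n"
          using q by (simp add: power_mult power_mult_distrib)
        also have "\<dots> \<le> (1 / 2) ^ n"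
          using elim q by (intro power_mono) auto
        finally show ?case .
      qed
    qed simp
    then have "(\<lambda>n. \<bar>w\<bar> ^ n * q ^ (n * n)) summable_on UNIV"
      using q by (intro summable_nonneg_imp_summable_on) auto
    also have "(\<lambda>n. \<bar>w\<bar> ^ n * q ^ (n * n)) = (\<lambda>j. \<bar>w powi j * q powi j\<^sup>2\<bar>) \<circ> int"
      using q by (simp add: fun_eq_iff abs_mult power_abs power2_eq_square flip: of_nat_mult)
    finally show "((\<lambda>j. \<bar>w powi j * q powi j\<^sup>2\<bar>) \<circ> int) summable_on UNIV" .
  qed (simp add: inj_on_def)
  have "(\<lambda>j. \<bar>(1 / z) powi j * q powi (j\<^sup>2)\<bar>) summable_on range int"
    by (rule half)
  also have "(\<lambda>j. \<bar>(1 / z) powi j * q powi (j\<^sup>2)\<bar>) = (\<lambda>j. \<bar>z powi j * q powi (j\<^sup>2)\<bar>) \<circ> uminus"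
    by (simp add: fun_eq_iff power_int_minus power_int_divide_distrib inverse_eq_divide)
  also have "\<dots> summable_on range int \<longleftrightarrow> (\<lambda>j. \<bar>z powi j * q powi (j\<^sup>2)\<bar>) summable_on uminus ` range int"
    by (rule summable_on_reindex [symmetric]) (simp add: inj_on_def)
  finally have "(\<lambda>j. \<bar>z powi j * q powi (j\<^sup>2)\<bar>) summable_on range int \<union> uminus ` range int"
    by (intro summable_on_union half)
  moreover have "range int \<union> uminus ` range int = UNIV"
  proof -
    have "x \<in> range int \<union> uminus ` range int" for x
      by (cases x rule: int_cases2) auto
    then show ?thesis by blast
  qed
  ultimately show ?thesis by simp
qed

end

text \<open>The limit of the finite triple product: every coefficient tends to $1/(q^2;q^2)_\infty^2$, and
  they are bounded by this number.\<close>

lemma jacobi_triple_product: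
  assumes q: "0 < q" "q < 1" and z: "z \<noteq> 0"
  shows "((\<lambda>j. (- z) powi j * q powi (j\<^sup>2)) has_sum
    qpoch_inf (z * q) (q\<^sup>2) * qpoch_inf (q / z) (q\<^sup>2) * qpoch_inf (q\<^sup>2) (q\<^sup>2)) UNIV"
proof -
  have Q: "0 < q\<^sup>2" "q\<^sup>2 < 1" "\<bar>q\<^sup>2\<bar> < 1"
    using q by (auto simp: power_less_one_iff)
  let ?P = "qpoch_inf (q\<^sup>2) (q\<^sup>2)"
  let ?t = "\<lambda>j. (- z) powi j * q powi (j\<^sup>2)"
  note P = qfact_inf_pos [OF Q(1,2)]
  have nz: "qpoch (q\<^sup>2) (q\<^sup>2) k \<noteq> 0" for k
    using qfact_pos [OF Q(1,2), of k] by simp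
  have "((\<lambda>j. ?t j * (1 / ?P)\<^sup>2) has_sum qpoch_inf (z * q) (q\<^sup>2) * qpoch_inf (q / z) (q\<^sup>2) / ?P) UNIV"
  proof (rule tannery_has_sum)
    show "(\<lambda>n. ?t j * central (q\<^sup>2) n j) \<longlonglongrightarrow> ?t j * (1 / ?P)\<^sup>2" for j
      by (intro tendsto_intros central_tendsto Q)
    show "norm (?t j * central (q\<^sup>2) n j) \<le> \<bar>?t j\<bar> * (1 / ?P)\<^sup>2" for n j
      unfolding real_norm_def abs_mult [of "?t j"] by (intro mult_left_mono abs_central_le Q) simp
    show "(\<lambda>j. \<bar>?t j\<bar> * (1 / ?P)\<^sup>2) summable_on UNIV"
      using z by (intro summable_on_cmult_left summable_theta q) simp
    show "((\<lambda>j. ?t j * central (q\<^sup>2) n j) has_sum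
      qpoch (z * q) (q\<^sup>2) (Suc n) * qpoch (q / z) (q\<^sup>2) n / qpoch (q\<^sup>2) (q\<^sup>2) (2 * n + 1)) UNIV" for n
      using q z by (intro has_sum_finite_neutralI [of "{- int n..int n + 1}"]
          finite_jacobi_triple_product nz) (auto simp: central_eq_0)
    have "filterlim (\<lambda>n. 2 * n + 1) sequentially sequentially"
      by real_asymp
    from filterlim_compose [OF qpoch_tendsto [OF Q(3)] this]
    show "(\<lambda>n. qpoch (z * q) (q\<^sup>2) (Suc n) * qpoch (q / z) (q\<^sup>2) n / qpoch (q\<^sup>2) (q\<^sup>2) (2 * n + 1)) \<longlonglongrightarrow>
       qpoch_inf (z * q) (q\<^sup>2) * qpoch_inf (q / z) (q\<^sup>2) / ?P"
      using P by (intro tendsto_intros qpoch_tendsto [OF Q(3), THEN LIMSEQ_Suc] qpoch_tendsto [OF Q(3)]) auto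
  qed
  from has_sum_cmult_left [OF this, of "?P\<^sup>2"] show ?thesis
    using P by (simp add: power_divide power2_eq_square mult.assoc)
qed

section \<open>The series of the signed partitions as a theta series\<close>

text \<open>Combinatorially this is the decomposition of a partition by its largest rectangle with sides
  $m$ and $m + d$. The proof shows instead that the sum does not depend on $d$, by telescoping, and
  lets $d$ tend to infinity, where only the term for $m = 0$ survives.\<close>

lemma durfee_sum:
  fixes q :: real
  assumes q: "0 < q" "q < 1"
  shows "((\<lambda>m. q ^ (m * (m + d)) * (qfact_inv q (int m) * qfact_inv q (int (m + d)))) has_sum
    1 / qpoch_inf q q) UNIV"
proof -
  define f where "f = (\<lambda>d m. q ^ (m * (m + d)) * (qfact_inv q (int m) * qfact_inv q (int (m + d))))"
  \<comment> \<open>Cancelling 1 - q^m against (q;q)_m shows that h d (m + 1) is q^(m+d+1) times f (d + 1) m,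
      and q^m times f d m is the remaining part of f (d + 1) m, with the factor 1 - q^(m+d+1).\<close>
  define h where "h = (\<lambda>d m. (1 - q ^ m) * f d m)"
  let ?P = "qpoch_inf q q"
  note bnd = qfact_inv_bounds [OF q]
  have M: "summable (\<lambda>m. q ^ m * (1 / ?P)\<^sup>2)"
    using q by (intro summable_mult2) simp
  have f_nonneg: "0 \<le> f d m" for d m
    unfolding f_def using q bnd by (intro mult_nonneg_nonneg) auto
  have f_le: "f d m \<le> q ^ m * (1 / ?P)\<^sup>2" for d m
  proof -
    have "q ^ (m * (m + d)) \<le> q ^ m"
      using q by (intro power_decreasing) (cases m; auto)+
    moreover have "qfact_inv q (int m) * qfact_inv q (int (m + d)) \<le> (1 / ?P)\<^sup>2"
      unfolding power2_eq_square using bnd qfact_inf_pos [OF q] by (intro mult_mono) (auto simp: less_imp_le)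
    ultimately show ?thesis
      unfolding f_def using q bnd by (intro mult_mono mult_nonneg_nonneg) auto
  qed
  have f_summable: "summable (f d)" for d
    by (rule summable_comparison_test' [OF M, of 0]) (use f_nonneg f_le in auto)
  have inv_Suc: "(1 - q ^ Suc k) * qfact_inv q (int (Suc k)) = qfact_inv q (int k)" for k
    using qfact_pos [OF q, of "Suc k"] by (auto simp: qfact_inv_def qpoch_Suc nat_add_distrib simp del: of_nat_Suc)
  have step: "f d m - f (Suc d) m = h d m - h d (Suc m)" for d m
  proof -
    have "f (Suc d) m = q ^ (m + d + 1) * f (Suc d) m + (1 - q ^ Suc (m + d)) * f (Suc d) m"
      by (simp add: algebra_simps)
    also have "(1 - q ^ Suc (m + d)) * f (Suc d) m =
        q ^ (m * (m + Suc d)) * (qfact_inv q (int m) * ((1 - q ^ Suc (m + d)) * qfact_inv q (int (Suc (m + d)))))"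
      unfolding f_def add_Suc_right by (simp only: mult_ac)
    also have "\<dots> = q ^ m * f d m"
      unfolding inv_Suc by (simp add: f_def power_add algebra_simps)
    also have "q ^ (m + d + 1) * f (Suc d) m =
        q ^ (Suc m * (Suc m + d)) * (qfact_inv q (int m) * qfact_inv q (int (Suc m + d)))"
      by (simp add: f_def power_add algebra_simps)
    also have "\<dots> = h d (Suc m)"
      unfolding inv_Suc [of m, symmetric] f_def h_def by (simp only: mult_ac)
    finally show ?thesis
      by (simp add: h_def algebra_simps)
  qed
  have "suminf (f (Suc d)) = suminf (f d)" for d
  proof -
    have "h d \<longlonglongrightarrow> (1 - 0) * 0"
      unfolding h_def using q by (intro tendsto_intros summable_LIMSEQ_zero f_summable LIMSEQ_realpow_zero) auto
    then have "(\<lambda>m. f d m - f (Suc d) m) sums (h d 0 - 0)"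
      unfolding step by (intro telescope_sums') simp
    moreover have "(\<lambda>m. f d m - f (Suc d) m) sums (suminf (f d) - suminf (f (Suc d)))"
      by (intro sums_diff summable_sums f_summable)
    ultimately have "h d 0 - 0 = suminf (f d) - suminf (f (Suc d))"
      by (rule sums_unique2)
    then show ?thesis by (simp add: h_def)
  qed
  then have const: "suminf (f d) = suminf (f 0)" for d
    by (induction d) auto
  have hs: "(f d has_sum suminf (f 0)) UNIV" for d
  proof (rule norm_summable_imp_has_sum)
    show "summable (\<lambda>m. norm (f d m))"
      using f_summable [of d] f_nonneg by simp
    show "f d sums suminf (f 0)"
      using summable_sums [OF f_summable [of d]] unfolding const [of d] .
  qed
  have "((\<lambda>m::nat. if m = 0 then 1 / ?P else 0) has_sum suminf (f 0)) UNIV"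
  proof (rule tannery_has_sum [where f = f and S = "\<lambda>_. suminf (f 0)", OF _ _ _ hs tendsto_const])
    show "(\<lambda>d. f d m) \<longlonglongrightarrow> (if m = 0 then 1 / ?P else 0)" for m
    proof (cases "m = 0")
      case True
      have "filterlim (\<lambda>n. int n) at_top sequentially" by real_asymp
      from qfact_inv_tendsto [OF q this] show ?thesis
        using True by (simp add: f_def qfact_inv_def [of q 0])
    next
      case False
      have "(\<lambda>d. f d m) \<longlonglongrightarrow> 0"
      proof (rule tendsto_sandwich [where f = "\<lambda>_. 0"])
        have "q ^ (m * (m + d)) * (qfact_inv q (int m) * qfact_inv q (int (m + d))) \<le> q ^ d * (1 / ?P)\<^sup>2" for d
        proof (intro mult_mono)
          show "q ^ (m * (m + d)) \<le> q ^ d"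
            using q False by (intro power_decreasing) (cases m; auto)+
          show "qfact_inv q (int m) * qfact_inv q (int (m + d)) \<le> (1 / ?P)\<^sup>2"
            unfolding power2_eq_square using bnd qfact_inf_pos [OF q] by (intro mult_mono) (auto simp: less_imp_le)
        qed (use q bnd in auto)
        then show "\<forall>\<^sub>F d in sequentially. f d m \<le> q ^ d * (1 / ?P)\<^sup>2"
          by (simp add: f_def)
        have "(\<lambda>d. q ^ d * (1 / ?P)\<^sup>2) \<longlonglongrightarrow> 0 * (1 / ?P)\<^sup>2"
          using q by (intro tendsto_intros LIMSEQ_realpow_zero) auto
        then show "(\<lambda>d. q ^ d * (1 / ?P)\<^sup>2) \<longlonglongrightarrow> 0" by simp
      qed (use f_nonneg in auto)
      with False show ?thesis by simp
    qed
    show "norm (f d m) \<le> q ^ m * (1 / ?P)\<^sup>2" for d m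
      using f_nonneg f_le by simp
    show "(\<lambda>m. q ^ m * (1 / ?P)\<^sup>2) summable_on UNIV"
      using q by (intro summable_nonneg_imp_summable_on M) auto
  qed
  moreover have "((\<lambda>m::nat. if m = 0 then 1 / ?P else 0) has_sum 1 / ?P) UNIV"
    by (rule has_sum_finite_neutralI [of "{0}"]) auto
  ultimately have "suminf (f 0) = 1 / ?P"
    by (rule has_sum_unique)
  with hs [of d] show ?thesis
    by (simp add: f_def)
qed

lemma central_reflect: "central q n (1 - k) = central q n k"
proof -
  have "int n + (1 - k) = int n + 1 - k" "int n + 1 - (1 - k) = int n + k" by auto
  then show ?thesis by (simp only: central_def mult.commute)
qed

text \<open>For $k = e + 1 \ge 1$ the terms with $n < e$ vanish, and the shift $n = m + e$ turns the sum
  into the Durfee sum with $d = 2e + 1$. The other $k$ follow from the symmetry $k \mapsto 1 - k$.\<close>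

lemma central_sum:
  fixes q :: real
  assumes q: "0 < q" "q < 1"
  shows "((\<lambda>n. q ^ (n * n + n) * central q n k) has_sum q powi (k\<^sup>2 - k) / qpoch_inf q q) UNIV"
proof -
  have pos: "((\<lambda>n. q ^ (n * n + n) * central q n (int (Suc e))) has_sum
      q powi ((int (Suc e))\<^sup>2 - int (Suc e)) / qpoch_inf q q) UNIV" for e
  proof -
    have "((\<lambda>n. q ^ (n * n + n) * central q n (int (Suc e))) has_sum
      q powi ((int (Suc e))\<^sup>2 - int (Suc e)) / qpoch_inf q q) (range (\<lambda>m. m + e))"
    proof (subst has_sum_reindex)
      have "((\<lambda>m. q ^ (e * e + e) * (q ^ (m * (m + (2 * e + 1))) *
          (qfact_inv q (int m) * qfact_inv q (int (m + (2 * e + 1)))))) has_sum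
          q ^ (e * e + e) * (1 / qpoch_inf q q)) UNIV"
        by (intro has_sum_cmult_right durfee_sum q)
      also have "(\<lambda>m. q ^ (e * e + e) * (q ^ (m * (m + (2 * e + 1))) *
          (qfact_inv q (int m) * qfact_inv q (int (m + (2 * e + 1)))))) =
          (\<lambda>n. q ^ (n * n + n) * central q n (int (Suc e))) \<circ> (\<lambda>m. m + e)"
      proof (rule ext)
        fix m
        have i: "int (m + e) + int (Suc e) = int (m + (2 * e + 1))" "int (m + e) + 1 - int (Suc e) = int m"
          by auto
        have "q ^ (e * e + e) * q ^ (m * (m + (2 * e + 1))) = q ^ ((m + e) * (m + e) + (m + e))"
          unfolding power_add [symmetric] by (rule arg_cong [of _ _ "power q"]) (simp add: algebra_simps)
        note E = this [symmetric]
        show "q ^ (e * e + e) * (q ^ (m * (m + (2 * e + 1))) *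
          (qfact_inv q (int m) * qfact_inv q (int (m + (2 * e + 1))))) =
          ((\<lambda>n. q ^ (n * n + n) * central q n (int (Suc e))) \<circ> (\<lambda>m. m + e)) m"
          unfolding o_def central_def i E by (simp only: mult_ac)
      qed
      also have "q ^ (e * e + e) = q powi ((int (Suc e))\<^sup>2 - int (Suc e))"
        unfolding power_int_of_nat [symmetric]
        by (rule arg_cong [of _ _ "power_int q"]) (simp add: power2_eq_square algebra_simps)
      finally show "((\<lambda>n. q ^ (n * n + n) * central q n (int (Suc e))) \<circ> (\<lambda>m. m + e) has_sum
          q powi ((int (Suc e))\<^sup>2 - int (Suc e)) / qpoch_inf q q) UNIV"
        by (simp only: times_divide_eq_right mult_1_right)
    qed (simp add: inj_on_def)
    also have "?this \<longleftrightarrow> ?thesis"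
    proof (rule has_sum_cong_neutral)
      fix n assume "n \<in> UNIV - range (\<lambda>m. m + e)"
      then have "n < e" by (metis DiffE le_add_diff_inverse2 not_less rangeI)
      then show "q ^ (n * n + n) * central q n (int (Suc e)) = 0"
        by (simp add: central_eq_0)
    qed auto
    finally show ?thesis .
  qed
  show ?thesis
  proof (cases "k \<ge> 1")
    case True
    then have "k = int (Suc (nat (k - 1)))" by simp
    then show ?thesis using pos by metis
  next
    case False
    then have k: "1 - k = int (Suc (nat (- k)))" by simp
    have e: "(1 - k)\<^sup>2 - (1 - k) = k\<^sup>2 - k"
      by (simp add: power2_eq_square algebra_simps)
    show ?thesis using pos [of "nat (- k)"] unfolding k [symmetric] central_reflect e .
  qed
qed

text \<open>Each summand on the left is a finite sum over $j$ by \<open>cyclotomic_sum\<close>. The factor $q^{2n+1}$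
  that comes with it leaves the exponent $2n^2 + 2n$ for the sum over $n$, which \<open>central_sum\<close>
  evaluates in base $q^2$ once the order of summation is exchanged.\<close>

lemma cyclotomic_series:
  fixes q :: real
  assumes q: "0 < q" "q < 1" and L: "((\<lambda>l. chi3 l * (- 1) powi (l - 1) * q powi (3 * l\<^sup>2 - 2 * l - 1)) has_sum L) UNIV"
  shows "((\<lambda>n. q ^ (2 * n * n + 4 * n) * (\<Prod>i<n. 1 + q ^ (2 * i + 1) + q ^ (4 * i + 2)) /
     qpoch (q\<^sup>2) (q\<^sup>2) (2 * n + 1)) has_sum L / qpoch_inf (q\<^sup>2) (q\<^sup>2)) UNIV"
proof -
  have Q: "0 < q\<^sup>2" "q\<^sup>2 < 1"
    using q by (auto simp: power_less_one_iff)
  let ?P = "qpoch_inf (q\<^sup>2) (q\<^sup>2)"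
  have nz: "qpoch (q\<^sup>2) (q\<^sup>2) k \<noteq> 0" for k
    using qfact_pos [OF Q(1,2), of k] by simp
  define c where "c = (\<lambda>j. (- 1) powi (j - 1) * chi3 j * q powi (j\<^sup>2 - 1))"
  define F where "F = (\<lambda>(j, n). c j * ((q\<^sup>2) ^ (n * n + n) * central (q\<^sup>2) n j))"
  have "F summable_on UNIV \<times> UNIV"
  proof -
    have "(\<lambda>j. \<bar>c j\<bar>) summable_on UNIV"
    proof (rule summable_on_comparison_test)
      show "(\<lambda>j. \<bar>1 powi j * q powi j\<^sup>2\<bar> * (1 / q)) summable_on UNIV"
        by (intro summable_on_cmult_left summable_theta q) simp
      show "\<bar>c j\<bar> \<le> \<bar>1 powi j * q powi j\<^sup>2\<bar> * (1 / q)" for j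
        using q by (simp add: c_def abs_mult chi3_def power_int_diff power_int_abs)
    qed simp
    then obtain a where a: "((\<lambda>j. \<bar>c j\<bar>) has_sum a) UNIV"
      unfolding summable_on_def by blast
    have "summable (\<lambda>n. (1 / ?P)\<^sup>2 * (q\<^sup>2) ^ n)"
      using Q by (intro summable_mult) simp
    then have "(\<lambda>n. (1 / ?P)\<^sup>2 * (q\<^sup>2) ^ n) summable_on UNIV"
      using Q by (intro summable_nonneg_imp_summable_on) auto
    then obtain b where b: "((\<lambda>n. (1 / ?P)\<^sup>2 * (q\<^sup>2) ^ n) has_sum b) UNIV"
      unfolding summable_on_def by blast
    have "(\<lambda>(j, n). \<bar>c j\<bar> * ((1 / ?P)\<^sup>2 * (q\<^sup>2) ^ n)) summable_on UNIV \<times> UNIV"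
      using has_sum_product_real [OF a b] by (rule has_sum_imp_summable)
    from Infinite_Sum.abs_summable_on_comparison_test' [OF this, of F]
    show ?thesis
    proof (rule abs_summable_summable)
      fix x :: "int \<times> nat"
      obtain j n where x: "x = (j, n)" by (cases x)
      have "\<bar>(q\<^sup>2) ^ (n * n + n) * central (q\<^sup>2) n j\<bar> = (q\<^sup>2) ^ (n * n + n) * \<bar>central (q\<^sup>2) n j\<bar>"
        using Q by (simp add: abs_mult)
      also have "\<dots> \<le> (q\<^sup>2) ^ n * (1 / ?P)\<^sup>2"
        using Q by (intro mult_mono abs_central_le power_decreasing) auto
      finally show "norm (F x) \<le> (case x of (j, n) \<Rightarrow> \<bar>c j\<bar> * ((1 / ?P)\<^sup>2 * (q\<^sup>2) ^ n))"
        by (simp add: x F_def abs_mult mult_left_mono mult.commute del: power2_abs)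
    qed
  qed
  then obtain S where S: "(F has_sum S) (UNIV \<times> UNIV)"
    unfolding summable_on_def by blast
  have "((\<lambda>j. c j * ((q\<^sup>2) powi (j\<^sup>2 - j) / ?P)) has_sum S) UNIV"
  proof (rule has_sum_SigmaD [OF S])
    show "((\<lambda>n. F (j, n)) has_sum c j * ((q\<^sup>2) powi (j\<^sup>2 - j) / ?P)) UNIV" for j
      unfolding F_def prod.case by (intro has_sum_cmult_right central_sum Q)
  qed
  also have "(\<lambda>j. c j * ((q\<^sup>2) powi (j\<^sup>2 - j) / ?P)) =
      (\<lambda>j. chi3 j * (- 1) powi (j - 1) * q powi (3 * j\<^sup>2 - 2 * j - 1) * (1 / ?P))"
  proof (rule ext)
    fix j
    have "(q\<^sup>2) powi (j\<^sup>2 - j) = q powi (2 * (j\<^sup>2 - j))"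
      unfolding power_int_mult by simp
    moreover have "q powi (j\<^sup>2 - 1) * q powi (2 * (j\<^sup>2 - j)) = q powi (3 * j\<^sup>2 - 2 * j - 1)"
    proof -
      have "q powi (j\<^sup>2 - 1) * q powi (2 * (j\<^sup>2 - j)) = q powi (j\<^sup>2 - 1 + 2 * (j\<^sup>2 - j))"
        using q by (subst power_int_add) auto
      also have "j\<^sup>2 - 1 + 2 * (j\<^sup>2 - j) = 3 * j\<^sup>2 - 2 * j - 1"
        by simp
      finally show ?thesis .
    qed
    ultimately show "c j * ((q\<^sup>2) powi (j\<^sup>2 - j) / ?P) =
      chi3 j * (- 1) powi (j - 1) * q powi (3 * j\<^sup>2 - 2 * j - 1) * (1 / ?P)"
      by (simp add: c_def mult_ac flip: mult.assoc)
  qed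
  finally have "((\<lambda>j. chi3 j * (- 1) powi (j - 1) * q powi (3 * j\<^sup>2 - 2 * j - 1) * (1 / ?P)) has_sum S) UNIV" .
  from has_sum_unique [OF this has_sum_cmult_left [OF L]] have "S = L / ?P" by simp
  moreover have "((\<lambda>n. q ^ (2 * n * n + 4 * n) * (\<Prod>i<n. 1 + q ^ (2 * i + 1) + q ^ (4 * i + 2)) /
     qpoch (q\<^sup>2) (q\<^sup>2) (2 * n + 1)) has_sum S) UNIV"
  proof (rule has_sum_SigmaD [OF S [unfolded has_sum_swap [of F]]])
    fix n
    let ?T = "(\<Prod>i<n. 1 + q ^ (2 * i + 1) + q ^ (4 * i + 2)) / qpoch (q\<^sup>2) (q\<^sup>2) (2 * n + 1)"
    have e: "c j = - (1 / q) * ((- 1) powi j * chi3 j * q powi j\<^sup>2)" for j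
      using q by (simp add: c_def power_int_diff)
    have "((\<lambda>j. F (j, n)) has_sum (\<Sum>j\<in>{- int n..int n + 1}. F (j, n))) UNIV"
      by (rule has_sum_finite_neutralI [of "{- int n..int n + 1}"]) (auto simp: F_def central_eq_0)
    also have "(\<Sum>j\<in>{- int n..int n + 1}. F (j, n)) = (q\<^sup>2) ^ (n * n + n) * (1 / q) *
       (- (\<Sum>j\<in>{- int n..int n + 1}. (- 1) powi j * chi3 j * q powi (j\<^sup>2) * central (q\<^sup>2) n j))"
      by (simp add: F_def e sum_distrib_left sum_negf mult_ac)
    also have "\<dots> = (q\<^sup>2) ^ (n * n + n) * (1 / q) * (q ^ (2 * n + 1) * ?T)"
      using cyclotomic_sum [of q n] q nz by simp
    also have "\<dots> = (q ^ (2 * (n * n + n)) * q ^ (2 * n)) * ?T"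
      unfolding power_mult [symmetric, of q 2 "n * n + n"] using q by simp
    also have "q ^ (2 * (n * n + n)) * q ^ (2 * n) = q ^ (2 * n * n + 4 * n)"
      unfolding power_add [symmetric] by (rule arg_cong [of _ _ "power q"]) (simp add: algebra_simps)
    finally show "((\<lambda>j. (\<lambda>(x, y). F (y, x)) (n, j)) has_sum
      q ^ (2 * n * n + 4 * n) * (\<Prod>i<n. 1 + q ^ (2 * i + 1) + q ^ (4 * i + 2)) /
       qpoch (q\<^sup>2) (q\<^sup>2) (2 * n + 1)) UNIV"
      by simp
  qed
  ultimately show ?thesis by simp
qed

section \<open>The quintuple product\<close>

text \<open>The left-hand product, multiplied by $(p^{12};p^{12})_\infty$, is a product of two triple
  products with summation indices $m$ and $n$. The power of $z$ is $l - 1$ with $l = m + 2n + 1$.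
  For fixed $l$ the exponent of $p$ is $(l^2 - 1) + 2(l-3n-1)(l-3n-2)$, where the second term
  depends only on $l - 3n$. Hence the sum over $n$ depends only on $l$ modulo 3, up to sign:
  it is a pentagonal number series, its negative, or a series that vanishes by antisymmetry.\<close>

lemma quintuple_product:
  fixes p z :: real
  assumes p: "0 < p" "p < 1" and z: "z \<noteq> 0"
  shows "((\<lambda>l. chi3 l * z powi (l - 1) * p powi (l\<^sup>2 - 1)) has_sum
    qpoch_inf (z * p ^ 3) (p ^ 6) * qpoch_inf (p ^ 3 / z) (p ^ 6) * qpoch_inf (p ^ 6) (p ^ 6) *
    (qpoch_inf (z\<^sup>2 * p ^ 12) (p ^ 12) * qpoch_inf (1 / z\<^sup>2) (p ^ 12))) UNIV"
proof -
  have pk: "0 < p ^ k" "k > 0 \<Longrightarrow> p ^ k < 1" for k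
    using p by (auto simp: power_less_one_iff)
  have pw: "(p ^ a) powi k = p powi (int a * k)" for a k
    by (simp add: power_int_mult)
  have padd: "p powi i * p powi j = p powi (i + j)" for i j
    using p by (subst power_int_add) auto
  have even_sign: "(- 1 :: real) powi (2 * t + i) = (- 1) powi i" for t i
    by (subst power_int_add) (auto simp: power_int_mult)
  have sign: "(- 1 :: real) powi (- 1 - s) = - ((- 1) powi s)" "(- 1 :: real) powi (- s) = (- 1) powi s"
    "(- 1 :: real) powi (1 - s) = - ((- 1) powi s)" for s
    by (simp_all add: power_int_minus_left)
  let ?E = "qpoch_inf (p ^ 12) (p ^ 12)"
  have E: "?E \<noteq> 0"
    using qfact_inf_pos [OF pk(1,2), of 12] by simp
  have theta: "((\<lambda>s. (- 1) powi s * p powi (18 * s\<^sup>2 + int a * s)) has_sum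
      qpoch_inf (p ^ (18 + a)) (p ^ 36) * qpoch_inf (p ^ 18 / p ^ a) (p ^ 36) * qpoch_inf (p ^ 36) (p ^ 36)) UNIV" for a
  proof -
    have "(- (p ^ a)) powi s * (p ^ 18) powi s\<^sup>2 = (- 1) powi s * p powi (18 * s\<^sup>2 + int a * s)" for s
      using power_int_mult_distrib [of "- 1" "p ^ a" s] by (simp add: pw padd mult.assoc add.commute)
    then show ?thesis
      using jacobi_triple_product [OF pk(1,2), of 18 "p ^ a"] p
      by (simp add: add.commute flip: power_add power_mult)
  qed
  \<comment> \<open>Euler's pentagonal number theorem for p^12: the three products are the residue classes
      modulo 3 of a single one.\<close>
  have pent: "((\<lambda>s. (- 1) powi s * p powi (18 * s\<^sup>2 + 6 * s)) has_sum ?E) UNIV"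
  proof -
    have "p ^ 18 / p ^ 6 = p ^ 12"
      using p by (simp flip: power_diff)
    moreover have "?E = qpoch_inf (p ^ 24) (p ^ 36) * qpoch_inf (p ^ 12) (p ^ 36) * qpoch_inf (p ^ 36) (p ^ 36)"
      using pk[of 12] by (subst qpoch_inf_dissect [of _ 3])
        (auto simp: numeral_3_eq_3 mult_ac simp flip: power_add power_mult power_Suc)
    ultimately show ?thesis
      using theta [of 6] by simp
  qed
  have pent': "((\<lambda>s. (- 1) powi s * p powi (18 * s\<^sup>2 - 6 * s)) has_sum ?E) UNIV"
    using pent by (subst has_sum_reindex_bij_witness [of _ uminus uminus _ _ _ ?E])
      (auto simp: sign)
  \<comment> \<open>The triple product vanishes here because one of its products has the factor 1 - 1.\<close>
  have zero: "((\<lambda>s. (- 1) powi s * p powi (18 * s\<^sup>2 + 18 * s)) has_sum 0) UNIV"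
  proof -
    have "qpoch_inf 1 (p ^ 36) = 0"
      using pk [of 36] by (subst qpoch_inf_eq_0_iff) (auto intro: exI [of _ 0])
    then show ?thesis
      using theta [of 18] p by simp
  qed
  have inner: "((\<lambda>n. (- 1) powi (l - 1 - n) * p powi (2 * (l - 3 * n - 1) * (l - 3 * n - 2))) has_sum chi3 l * ?E) UNIV"
    for l
  proof -
    \<comment> \<open>With l = 3 t + r and n = s + t, the number l - 3 n becomes r - 3 s.\<close>
    define t where "t = l div 3"
    define r where "r = l mod 3"
    have l: "l = 3 * t + r" by (simp add: t_def r_def)
    have r: "r = 0 \<or> r = 1 \<or> r = 2" unfolding r_def by presburger
    have "((\<lambda>s. (- 1) powi (r - 1 - s) * p powi (2 * (r - 3 * s - 1) * (r - 3 * s - 2))) has_sum chi3 l * ?E) UNIV"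
      using r
    proof (elim disjE)
      assume r: "r = 0"
      have "(- 1) powi (r - 1 - s) * p powi (2 * (r - 3 * s - 1) * (r - 3 * s - 2)) =
          - (p ^ 4) * ((- 1) powi s * p powi (18 * s\<^sup>2 + 18 * s))" for s
      proof -
        have "2 * (r - 3 * s - 1) * (r - 3 * s - 2) = 4 + (18 * s\<^sup>2 + 18 * s)"
          by (simp add: r power2_eq_square algebra_simps)
        moreover have "p powi (4 + i) = p ^ 4 * p powi i" for i
          by (simp flip: padd)
        ultimately show ?thesis
          by (simp add: r sign)
      qed
      moreover have "chi3 l = (0 :: real)" using r unfolding r_def by (auto simp: chi3_def)
      ultimately show ?thesis
        using has_sum_cmult_right [OF zero, of "- (p ^ 4)"] by simp
    next
      assume r: "r = 1"
      have "2 * (r - 3 * s - 1) * (r - 3 * s - 2) = 18 * s\<^sup>2 + 6 * s" for s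
        by (simp add: r power2_eq_square algebra_simps)
      moreover have "chi3 l = (1 :: real)" using r unfolding r_def by (auto simp: chi3_def)
      ultimately show ?thesis
        using pent by (simp add: r sign)
    next
      assume r: "r = 2"
      have "2 * (r - 3 * s - 1) * (r - 3 * s - 2) = 18 * s\<^sup>2 - 6 * s" for s
        by (simp add: r power2_eq_square algebra_simps)
      moreover have "chi3 l = (- 1 :: real)" using r unfolding r_def by (auto simp: chi3_def)
      ultimately show ?thesis
        using has_sum_uminusI [OF pent'] by (simp add: r sign)
    qed
    also have "?this \<longleftrightarrow> ?thesis"
    proof (rule has_sum_reindex_bij_witness [of _ "\<lambda>n. n - t" "\<lambda>s. s + t"])
      fix s
      have "l - 1 - (s + t) = 2 * t + (r - 1 - s)" "l - 3 * (s + t) = r - 3 * s"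
        by (simp_all add: l)
      then show "(- 1) powi (l - 1 - (s + t)) * p powi (2 * (l - 3 * (s + t) - 1) * (l - 3 * (s + t) - 2)) =
        (- 1) powi (r - 1 - s) * p powi (2 * (r - 3 * s - 1) * (r - 3 * s - 2))"
        by (simp only: even_sign)
    qed auto
    finally show ?thesis .
  qed
  define A where "A = qpoch_inf (z * p ^ 3) (p ^ 6) * qpoch_inf (p ^ 3 / z) (p ^ 6) * qpoch_inf (p ^ 6) (p ^ 6)"
  define B where "B = qpoch_inf (z\<^sup>2 * p ^ 12) (p ^ 12) * qpoch_inf (1 / z\<^sup>2) (p ^ 12)"
  have a: "((\<lambda>m. (- z) powi m * p powi (3 * m\<^sup>2)) has_sum A) UNIV"
    using jacobi_triple_product [OF pk(1,2) z, of 3]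
    by (simp add: A_def pw flip: power_mult)
  have b: "((\<lambda>n. (- (z\<^sup>2 * p ^ 6)) powi n * p powi (6 * n\<^sup>2)) has_sum B * ?E) UNIV"
    using jacobi_triple_product [OF pk(1,2), of 6 "z\<^sup>2 * p ^ 6"] z p
    by (simp add: B_def pw mult.assoc flip: power_mult power_add)
  let ?F = "\<lambda>(m, n). ((- z) powi m * p powi (3 * m\<^sup>2)) * ((- (z\<^sup>2 * p ^ 6)) powi n * p powi (6 * n\<^sup>2))"
  let ?G = "\<lambda>(l, n). z powi (l - 1) * p powi (l\<^sup>2 - 1) *
    ((- 1) powi (l - 1 - n) * p powi (2 * (l - 3 * n - 1) * (l - 3 * n - 2)))"
  have "(?F has_sum A * (B * ?E)) (UNIV \<times> UNIV)"
    by (rule has_sum_product_real [OF a b])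
  also have "?this \<longleftrightarrow> (?G has_sum A * (B * ?E)) (UNIV \<times> UNIV)"
  proof (rule has_sum_reindex_bij_witness [of _ "\<lambda>(l, n). (l - 1 - 2 * n, n)" "\<lambda>(m, n). (m + 2 * n + 1, n)"]; clarify?)
    fix m n :: int
    let ?l = "m + 2 * n + 1"
    have "(- z) powi m = (- 1) powi m * z powi m"
      using power_int_mult_distrib [of "- 1" z m] by simp
    moreover have "(- (z\<^sup>2 * p ^ 6)) powi n = (- 1) powi n * (z powi (2 * n) * p powi (6 * n))"
    proof -
      have "(z\<^sup>2 * p ^ 6) powi n = z powi (2 * n) * p powi (6 * n)"
        unfolding power_int_mult [of _ _ n] power_int_mult_distrib by simp
      then show ?thesis
        using power_int_mult_distrib [of "- 1" "z\<^sup>2 * p ^ 6" n] by simp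
    qed
    moreover have "(- 1 :: real) powi (?l - 1 - n) = (- 1) powi m * (- 1) powi n"
      by (subst power_int_add [symmetric]) (simp_all add: add.commute)
    moreover have "z powi (?l - 1) = z powi m * z powi (2 * n)"
      using z by (subst power_int_add [symmetric]) auto
    moreover have "p powi (3 * m\<^sup>2) * (p powi (6 * n) * p powi (6 * n\<^sup>2)) =
        p powi (?l\<^sup>2 - 1) * p powi (2 * (?l - 3 * n - 1) * (?l - 3 * n - 2))"
      unfolding padd by (rule arg_cong [of _ _ "power_int p"]) (simp add: power2_eq_square algebra_simps)
    ultimately show "z powi (?l - 1) * p powi (?l\<^sup>2 - 1) *
       ((- 1) powi (?l - 1 - n) * p powi (2 * (?l - 3 * n - 1) * (?l - 3 * n - 2))) =
      ((- z) powi m * p powi (3 * m\<^sup>2)) * ((- (z\<^sup>2 * p ^ 6)) powi n * p powi (6 * n\<^sup>2))"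
      by (simp only: mult_ac)
  qed auto
  finally have G: "(?G has_sum A * (B * ?E)) (UNIV \<times> UNIV)" .
  have "((\<lambda>l. z powi (l - 1) * p powi (l\<^sup>2 - 1) * (chi3 l * ?E)) has_sum A * (B * ?E)) UNIV"
    by (rule has_sum_SigmaD [OF G], unfold prod.case) (intro has_sum_cmult_right inner)
  from has_sum_cmult_left [OF this, of "1 / ?E"] show ?thesis
    using E by (simp add: A_def B_def mult_ac)
qed

section \<open>The product modulo 18\<close>

definition residues18 :: "nat set" where
  "residues18 = {2, 6, 7, 8, 10, 11, 12, 16}"

text \<open>Everything is expressed by the products over one residue class modulo 18 each. Those with
  negative first argument combine with the classes 7 and 11 to the classes 14 and 22 modulo 36,
  which together with 4 and 32 make up the classes 4 and 14 modulo 18. These two and 18 cancel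
  against the even classes in the denominator.\<close>

lemma product_side:
  fixes q :: real
  assumes q: "0 < q" "q < 1"
  shows "qpoch_inf (- (q ^ 7)) (q ^ 18) * qpoch_inf (- (q ^ 11)) (q ^ 18) * qpoch_inf (q ^ 18) (q ^ 18) *
      (qpoch_inf (q ^ 32) (q ^ 36) * qpoch_inf (q ^ 4) (q ^ 36)) / qpoch_inf (q\<^sup>2) (q\<^sup>2) =
    1 / (\<Prod>r\<in>residues18. qpoch_inf (q ^ r) (q ^ 18))"
proof -
  have qk: "\<bar>q ^ k\<bar> < 1" if "k > 0" for k
    using q that by (auto simp: power_less_one_iff)
  have nz: "qpoch_inf (q ^ k) (q ^ 18) \<noteq> 0" if "k > 0" for k
  proof -
    have "q ^ k * (q ^ 18) ^ i < 1" for i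
      unfolding power_mult [symmetric] power_add [symmetric] using q that by (auto simp: power_less_one_iff)
    then show ?thesis
      by (subst qpoch_inf_eq_0_iff) (use qk [of 18] in \<open>auto simp: less_le\<close>)
  qed
  have neg: "qpoch_inf (q ^ k) (q ^ 18) * qpoch_inf (- (q ^ k)) (q ^ 18) = qpoch_inf (q ^ (2 * k)) (q ^ 36)" for k
    using qpoch_inf_mult_neg [OF qk [of 18], of "q ^ k"] by (simp add: mult.commute flip: power_mult)
  have two: "qpoch_inf (q ^ k) (q ^ 18) = qpoch_inf (q ^ k) (q ^ 36) * qpoch_inf (q ^ (k + 18)) (q ^ 36)" for k
    using qpoch_inf_dissect [OF qk [of 18], of 2 "q ^ k"]
    by (simp add: numeral_2_eq_2 flip: power_mult power_add)
  have nine: "qpoch_inf (q\<^sup>2) (q\<^sup>2) = (\<Prod>r<9. qpoch_inf (q ^ (2 + 2 * r)) (q ^ 18))"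
    using qpoch_inf_dissect [OF qk [of 2], of 9 "q\<^sup>2"]
    by (simp flip: power_mult power_add)
  have nine': "qpoch_inf (q\<^sup>2) (q\<^sup>2) = (\<Prod>r\<in>{2,4,6,8,10,12,14,16,18}. qpoch_inf (q ^ r) (q ^ 18))"
  proof -
    have "{..<9::nat} = {0, 1, 2, 3, 4, 5, 6, 7, 8}" by auto
    then show ?thesis unfolding nine by (simp del: add_2_eq_Suc add_2_eq_Suc')
  qed
  show ?thesis
    using neg [of 7] neg [of 11] two [of 4] two [of 14] nz
      nz [of 4, unfolded two [of 4]] nz [of 14, unfolded two [of 14]]
    by (simp add: nine' residues18_def field_simps)
qed

text \<open>The series in \<open>cyclotomic_series\<close> is the quintuple product series for $p = q^3$ and
  $z = -q^{-2}$.\<close>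

lemma cyclotomic_series_eq_product:
  fixes q :: real
  assumes q: "0 < q" "q < 1"
  shows "((\<lambda>n. q ^ (2 * n * n + 4 * n) * (\<Prod>i<n. 1 + q ^ (2 * i + 1) + q ^ (4 * i + 2)) /
     qpoch (q\<^sup>2) (q\<^sup>2) (2 * n + 1)) has_sum
       1 / (\<Prod>r\<in>residues18. qpoch_inf (q ^ r) (q ^ 18))) UNIV"
  unfolding product_side [OF q, symmetric]
proof (rule cyclotomic_series [OF q])
  let ?z = "- (1 / q\<^sup>2)"
  have p: "0 < q ^ 3" "q ^ 3 < 1"
    using q by (auto simp: power_less_one_iff)
  have z: "?z \<noteq> 0" using q by simp
  have "?z powi (l - 1) * (q ^ 3) powi (l\<^sup>2 - 1) = (- 1) powi (l - 1) * q powi (3 * l\<^sup>2 - 2 * l - 1)" for l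
  proof -
    have "?z powi (l - 1) = (- 1) powi (l - 1) * q powi (- 2 * (l - 1))"
    proof -
      have "(1 / q\<^sup>2) powi (l - 1) = q powi (- 2 * (l - 1))"
        unfolding power_int_mult by (simp add: power_int_minus inverse_eq_divide)
      then show ?thesis
        using power_int_mult_distrib [of "- 1" "1 / q\<^sup>2" "l - 1"] by simp
    qed
    moreover have "(q ^ 3) powi (l\<^sup>2 - 1) = q powi (3 * (l\<^sup>2 - 1))"
      unfolding power_int_mult by simp
    moreover have "q powi (- 2 * (l - 1)) * q powi (3 * (l\<^sup>2 - 1)) = q powi (- 2 * (l - 1) + 3 * (l\<^sup>2 - 1))"
      using q by (subst power_int_add) auto
    moreover have "- 2 * (l - 1) + 3 * (l\<^sup>2 - 1) = 3 * l\<^sup>2 - 2 * l - 1" by simp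
    ultimately show ?thesis by (simp only: mult.assoc)
  qed
  note t = this
  have e: "?z * (q ^ 3) ^ 3 = - (q ^ 7)" "(q ^ 3) ^ 3 / ?z = - (q ^ 11)" "(q ^ 3) ^ 6 = q ^ 18"
     "?z\<^sup>2 * q ^ 36 = q ^ 32" "1 / ?z\<^sup>2 = q ^ 4" "(q ^ 3) ^ 12 = q ^ 36"
    using q by (auto simp: field_simps simp flip: power_mult power_add)
  show "((\<lambda>l. chi3 l * (- 1) powi (l - 1) * q powi (3 * l\<^sup>2 - 2 * l - 1)) has_sum
    qpoch_inf (- (q ^ 7)) (q ^ 18) * qpoch_inf (- (q ^ 11)) (q ^ 18) * qpoch_inf (q ^ 18) (q ^ 18) *
      (qpoch_inf (q ^ 32) (q ^ 36) * qpoch_inf (q ^ 4) (q ^ 36))) UNIV"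
    using quintuple_product [OF p z] unfolding e mult.assoc t .
qed

section \<open>Generating functions of partitions\<close>

text \<open>The second argument is the set of admissible multiplicities: all numbers for the ordinary
  partitions of the theorem, 0, 1 and 2 for the negative parts.\<close>

definition parts_in :: "nat set \<Rightarrow> nat set \<Rightarrow> nat list set" where
  "parts_in A M = {xs. is_partition xs \<and> set xs \<subseteq> A \<and> (\<forall>a\<in>A. count_list xs a \<in> M)}"

lemma replicate_count_append_filter:
  assumes "sorted_wrt (\<ge>) xs" "\<And>x. x \<in> set xs \<Longrightarrow> x \<le> (b::nat)"
  shows "replicate (count_list xs b) b @ filter (\<lambda>x. x \<noteq> b) xs = xs"
  using assms
proof (induction xs)
  case (Cons a xs)
  show ?case
  proof (cases "a = b")
    case True
    then show ?thesis using Cons by simp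
  next
    case False
    then have "b \<notin> set xs" "a < b"
      using Cons.prems by (auto simp: less_le) (metis order_antisym)
    then show ?thesis
      by (simp add: count_list_0_iff filter_id_conv) (metis filter_True)
  qed
qed simp

lemma count_list_replicate: "count_list (replicate k b) a = (if a = b then k else 0)"
  by (induction k) auto

text \<open>The parts can be chosen independently of each other. Adding them in increasing order puts the
  copies of the new part in front of the list.\<close>

lemma has_sum_parts_in:
  fixes y :: real
  assumes "finite A" "\<And>a. a \<in> A \<Longrightarrow> a > 0"
    and "\<And>a. a \<in> A \<Longrightarrow> ((\<lambda>k. y ^ (k * a)) has_sum g a) M"
  shows "((\<lambda>xs. y ^ sum_list xs) has_sum (\<Prod>a\<in>A. g a)) (parts_in A M)"
  using assms
proof (induction rule: finite_linorder_max_induct)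
  case empty
  have e: "parts_in {} M = {[]}"
    by (auto simp: parts_in_def is_partition_def)
  show ?case unfolding e by (rule has_sum_finiteI) auto
next
  case (insert b A)
  have less: "x < b" if "xs \<in> parts_in A M" "x \<in> set xs" for x xs
    using insert.hyps(2) that by (auto simp: parts_in_def)
  have "((\<lambda>(k, xs). y ^ (k * b) * y ^ sum_list xs) has_sum g b * (\<Prod>a\<in>A. g a)) (M \<times> parts_in A M)"
    using insert by (intro has_sum_product_real) auto
  also have "?this \<longleftrightarrow> ((\<lambda>xs. y ^ sum_list xs) has_sum (\<Prod>a\<in>insert b A. g a)) (parts_in (insert b A) M)"
  proof (rule has_sum_reindex_bij_witness [of _ "\<lambda>xs. (count_list xs b, filter (\<lambda>x. x \<noteq> b) xs)"
        "\<lambda>(k, xs). replicate k b @ xs"], goal_cases)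
    case (1 kx)
    then obtain k xs where kx: "kx = (k, xs)" "xs \<in> parts_in A M" by auto
    have "b \<notin> set xs" using less [OF kx(2)] by auto
    moreover from this have "filter (\<lambda>x. x \<noteq> b) xs = xs"
      by (intro filter_True) auto
    ultimately show ?case
      by (simp add: kx count_list_replicate)
  next
    case (2 kx)
    then obtain k xs where kx: "kx = (k, xs)" "k \<in> M" "xs \<in> parts_in A M" by auto
    have nb: "b \<notin> set xs" using less [OF kx(3)] by auto
    have "sorted_wrt (\<ge>) (replicate k b)" by (induction k) auto
    then show ?case
      using kx nb less [OF kx(3)] insert.prems(1) [of b] insert.hyps(2)
      by (auto simp: parts_in_def is_partition_def sorted_wrt_append count_list_replicate less_imp_le)
  next
    case (3 xs)
    then have "replicate (count_list xs b) b @ filter (\<lambda>x. x \<noteq> b) xs = xs"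
      using insert.hyps(2)
      by (intro replicate_count_append_filter) (auto simp: parts_in_def is_partition_def less_imp_le)
    then show ?case by simp
  next
    case (4 xs)
    have "count_list (filter (\<lambda>x. x \<noteq> b) xs) a = count_list xs a" if "a \<noteq> b" for a
      using that by (induction xs) auto
    then show ?case
      using 4 insert.hyps(2) by (auto simp: parts_in_def is_partition_def sorted_wrt_filter)
  next
    case (5 kx)
    then show ?case
      by (auto simp: sum_list_replicate power_add)
  next
    case 6
    show ?case using insert.hyps by (subst prod.insert) auto
  qed
  finally show ?case .
qed

lemma geometric_has_sum:
  fixes q :: real
  assumes "0 < q" "q < 1" "a > 0"
  shows "((\<lambda>k. q ^ (k * a)) has_sum 1 / (1 - q ^ a)) UNIV"
proof -
  have "q ^ a < 1" "0 < q ^ a"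
    using assms by (auto simp: power_less_one_iff)
  then have "(\<lambda>k. (q ^ a) ^ k) sums (1 / (1 - q ^ a))"
    by (intro geometric_sums) auto
  then show ?thesis
    using assms by (intro sums_nonneg_imp_has_sum) (auto simp: mult.commute simp flip: power_mult)
qed

text \<open>Sorting by weight turns a sum over objects into the power series that counts them.\<close>

lemma has_sum_weight_series:
  fixes q :: real
  assumes "((\<lambda>x. q ^ w x) has_sum L) W" and fin: "\<And>n. finite {x \<in> W. w x = n}"
  shows "((\<lambda>n. real (card {x \<in> W. w x = n}) * q ^ n) has_sum L) UNIV"
proof -
  have "((\<lambda>(n, x). q ^ w x) has_sum L) (SIGMA n:UNIV. {x \<in> W. w x = n}) \<longleftrightarrow> ((\<lambda>x. q ^ w x) has_sum L) W"
    by (rule has_sum_reindex_bij_witness [of _ "\<lambda>x. (w x, x)" snd]) auto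
  with assms(1) have "((\<lambda>(n, x). q ^ w x) has_sum L) (SIGMA n:UNIV. {x \<in> W. w x = n})"
    by simp
  then show ?thesis
  proof (rule has_sum_SigmaD)
    show "((\<lambda>x. case (n, x) of (n, x) \<Rightarrow> q ^ w x) has_sum real (card {x \<in> W. w x = n}) * q ^ n) {x \<in> W. w x = n}" for n
      by (rule has_sum_finiteI [OF fin]) simp
  qed
qed

text \<open>The equality of the sums is only known for $q$ to the right of 0, but the zeros of a nonzero
  power series are isolated, so that this is enough.\<close>

lemma power_series_unique:
  fixes a b :: "nat \<Rightarrow> real"
  assumes a: "\<And>q. 0 < q \<Longrightarrow> q < 1 \<Longrightarrow> ((\<lambda>n. a n * q ^ n) has_sum f q) UNIV"
    and b: "\<And>q. 0 < q \<Longrightarrow> q < 1 \<Longrightarrow> ((\<lambda>n. b n * q ^ n) has_sum f q) UNIV"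
  shows "a = b"
proof (rule ccontr)
  assume "a \<noteq> b"
  then obtain m where m: "a m \<noteq> b m" by auto
  \<comment> \<open>The difference of the series, multiplied by x, so that the zero at the origin is certain.\<close>
  define c where "c = (\<lambda>n. case n of 0 \<Rightarrow> 0 | Suc n \<Rightarrow> a n - b n)"
  define F where "F = (\<lambda>x. \<Sum>n. c n * (x - 0) ^ n)"
  have zero: "(\<lambda>n. c n * x ^ n) sums 0" if "0 < x" "x < 1" for x
  proof -
    have "(\<lambda>n. (a n * x ^ n - b n * x ^ n) * x) sums ((f x - f x) * x)"
      by (intro sums_mult2 sums_diff has_sum_imp_sums a b that)
    then have "(\<lambda>n. c (Suc n) * x ^ Suc n) sums 0"
      by (simp add: c_def algebra_simps)
    from sums_Suc [OF this] show ?thesis by (simp add: c_def)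
  qed
  obtain s where s: "0 < s" "\<And>z. z \<in> cball 0 s - {0} \<Longrightarrow> F z \<noteq> 0"
  proof (rule powser_0_nonzero [of 1 0 c F "Suc m"])
    fix x :: real assume "norm (x - 0) < 1"
    then obtain y where y: "\<bar>x\<bar> < y" "y < 1" "0 < y"
      using dense [of "\<bar>x\<bar>" 1] by force
    then have "summable (\<lambda>n. norm (c n * x ^ n))"
      using zero [of y] by (intro powser_insidea [of c y]) (auto simp: sums_iff)
    then show "(\<lambda>n. c n * (x - 0) ^ n) sums F x"
      unfolding F_def by (simp add: summable_norm_cancel summable_sums)
  next
    show "F 0 = 0" by (simp add: F_def c_def)
    show "c (Suc m) \<noteq> 0" using m by (simp add: c_def)
  qed auto
  define x where "x = min s (1 / 2)"
  have "0 < x" "x < 1" "x \<le> s"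
    using s(1) by (auto simp: x_def)
  then have "F x = 0"
    using zero [of x] by (simp add: F_def sums_iff)
  moreover have "F x \<noteq> 0"
    using \<open>0 < x\<close> \<open>x \<le> s\<close> by (intro s(2)) auto
  ultimately show False by simp
qed

section \<open>Ordinary partitions with restricted residues\<close>

lemma restricted_partitions_eq:
  "restricted_partitions n = {xs \<in> parts_in {p. p mod 18 \<in> residues18} UNIV. sum_list xs = n}"
proof -
  have "(\<exists>r\<in>{2, 6, 7, 8}. [int p = r] (mod 18) \<or> [int p = - r] (mod 18)) \<longleftrightarrow> p mod 18 \<in> residues18" for p
  proof -
    define m where "m = p mod 18"
    have h: "int p mod 18 = int m" by (simp add: m_def zmod_int)
    show ?thesis
      unfolding residues18_def unique_euclidean_semiring_class.cong_def h m_def [symmetric] by auto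
  qed
  then show ?thesis
    by (auto simp: restricted_partitions_def partition_of_def parts_in_def)
qed

lemma prod_residues18:
  "(\<Prod>a\<in>{a. a < n * 18 \<and> a mod 18 \<in> residues18}. 1 / (1 - q ^ a)) =
    1 / (\<Prod>r\<in>residues18. qpoch (q ^ r) (q ^ 18) n :: real)"
proof -
  have small: "r < 18" if "r \<in> residues18" for r
    using that by (auto simp: residues18_def)
  have "(\<Prod>a\<in>{a. a < n * 18 \<and> a mod 18 \<in> residues18}. 1 - q ^ a) =
      (\<Prod>(r, i)\<in>residues18 \<times> {..<n}. 1 - q ^ r * (q ^ 18) ^ i)"
  proof (rule prod.reindex_bij_witness [of _ "\<lambda>(r, i). r + 18 * i" "\<lambda>a. (a mod 18, a div 18)"], goal_cases)
    case (3 b)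
    then show ?case using small by auto
  next
    case (4 b)
    then show ?case using small by force
  next
    case (5 a)
    show ?case by (simp flip: power_mult power_add)
  qed (auto simp: div_less_iff_less_mult)
  also have "\<dots> = (\<Prod>r\<in>residues18. qpoch (q ^ r) (q ^ 18) n)"
    by (simp add: qpoch_def prod.cartesian_product)
  finally show ?thesis
    by (simp add: prod_dividef)
qed

text \<open>For the parts below $18n$ the generating function is a finite product. Its limit bounds all
  finite partial sums over partitions, and hence the sum over all partitions converges, to this
  limit.\<close>

lemma restricted_partitions_series:
  fixes q :: real
  assumes q: "0 < q" "q < 1"
  shows "((\<lambda>n. real (card (restricted_partitions n)) * q ^ n) has_sum
    1 / (\<Prod>r\<in>residues18. qpoch_inf (q ^ r) (q ^ 18))) UNIV"
proof -
  let ?A = "{p. p mod 18 \<in> residues18}"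
  define S where "S = (\<lambda>n. 1 / (\<Prod>r\<in>residues18. qpoch (q ^ r) (q ^ 18) n))"
  define An where "An = (\<lambda>n. {a. a < n * 18 \<and> a mod 18 \<in> residues18})"
  have pos: "a > 0" if "a mod 18 \<in> residues18" for a :: nat
    using that by (cases "a = 0") (auto simp: residues18_def)
  have fin: "((\<lambda>xs. q ^ sum_list xs) has_sum S n) (parts_in (An n) UNIV)" for n
    unfolding S_def An_def prod_residues18 [symmetric]
    by (rule has_sum_parts_in) (auto intro!: geometric_has_sum q pos)
  have q18: "\<bar>q ^ 18\<bar> < 1"
    using q by (auto simp: power_less_one_iff)
  have nz: "qpoch_inf (q ^ r) (q ^ 18) \<noteq> 0" if "r \<in> residues18" for r
  proof -
    have "r > 0" using that by (auto simp: residues18_def)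
    then have "q ^ r * (q ^ 18) ^ i < 1" for i
      unfolding power_mult [symmetric] power_add [symmetric] using q by (auto simp: power_less_one_iff)
    then show ?thesis
      by (subst qpoch_inf_eq_0_iff) (use q18 in \<open>auto simp: less_le\<close>)
  qed
  have lim: "S \<longlonglongrightarrow> 1 / (\<Prod>r\<in>residues18. qpoch_inf (q ^ r) (q ^ 18))"
    unfolding S_def using nz
    by (intro tendsto_divide tendsto_const tendsto_prod qpoch_tendsto q18) (auto simp: residues18_def)
  then obtain K where K: "\<And>n. \<bar>S n\<bar> \<le> K"
    using convergent_imp_Bseq [OF convergentI [OF lim]] by (auto simp: Bseq_def)
  have small: "\<exists>n. set xs \<subseteq> {..<n * 18}" for xs :: "nat list"
    by (rule exI [of _ "Suc (sum_list xs)"]) (auto dest!: member_le_sum_list)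
  have sub: "xs \<in> parts_in (An n) UNIV \<longleftrightarrow> xs \<in> parts_in ?A UNIV \<and> set xs \<subseteq> {..<n * 18}" for xs n
    by (auto simp: parts_in_def An_def)
  have "(\<lambda>xs. q ^ sum_list xs) summable_on parts_in ?A UNIV"
  proof (rule nonneg_bdd_above_summable_on)
    show "bdd_above (sum (\<lambda>xs. q ^ sum_list xs) ` {F. F \<subseteq> parts_in ?A UNIV \<and> finite F})"
    proof (rule bdd_aboveI2 [where M = K]; clarify)
      fix F assume F: "F \<subseteq> parts_in ?A UNIV" "finite F"
      obtain l where l: "set l = F" using finite_list [OF F(2)] by blast
      obtain n where n: "set (concat l) \<subseteq> {..<n * 18}" using small by blast
      with n F l have "F \<subseteq> parts_in (An n) UNIV"
        unfolding sub subset_iff by force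
      then have "(\<Sum>xs\<in>F. q ^ sum_list xs) \<le> S n"
        using q F by (intro finite_sum_le_has_sum [OF fin]) auto
      then show "(\<Sum>xs\<in>F. q ^ sum_list xs) \<le> K"
        using K [of n] by simp
    qed
  qed (use q in auto)
  then have "((\<lambda>xs. q ^ sum_list xs) has_sum 1 / (\<Prod>r\<in>residues18. qpoch_inf (q ^ r) (q ^ 18))) (parts_in ?A UNIV)"
  proof (rule tannery_has_sum [rotated 2])
    let ?f = "\<lambda>n xs. if set xs \<subseteq> {..<n * 18} then q ^ sum_list xs else 0"
    show "(?f n has_sum S n) (parts_in ?A UNIV)" for n
      using fin [of n] by (subst has_sum_cong_neutral [where T = "parts_in (An n) UNIV" and g = "\<lambda>xs. q ^ sum_list xs"]) (auto simp: sub)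
    show "S \<longlonglongrightarrow> 1 / (\<Prod>r\<in>residues18. qpoch_inf (q ^ r) (q ^ 18))" by (rule lim)
    fix xs :: "nat list"
    obtain N where N: "set xs \<subseteq> {..<N * 18}" using small by blast
    have "?f n xs = q ^ sum_list xs" if "n \<ge> N" for n
      using that N by (force simp: subset_iff)
    then show "(\<lambda>n. ?f n xs) \<longlonglongrightarrow> q ^ sum_list xs"
      by (intro tendsto_eventually eventually_sequentiallyI)
    show "norm (?f n xs) \<le> q ^ sum_list xs" for n
      using q by simp
  qed
  from has_sum_weight_series [OF this] show ?thesis
    using finite_restricted_partitions unfolding restricted_partitions_eq by simp
qed

section \<open>Signed partitions\<close>

text \<open>The last entry of a list of length $l + 1$ can be subtracted from all its entries, which leaves
  a list of length $l$ followed by 0. This contributes the factor $1/(1 - q^{l+1})$.\<close>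

lemma has_sum_decreasing_lists:
  fixes q :: real
  assumes q: "0 < q" "q < 1"
  shows "((\<lambda>xs. q ^ sum_list xs) has_sum 1 / qpoch q q l)
    {xs :: nat list. sorted_wrt (\<ge>) xs \<and> length xs = l}"
proof (induction l)
  case 0
  have e: "{xs :: nat list. sorted_wrt (\<ge>) xs \<and> length xs = 0} = {[]}" by auto
  show ?case unfolding e by (rule has_sum_finiteI) auto
next
  case (Suc l)
  let ?D = "\<lambda>l. {xs :: nat list. sorted_wrt (\<ge>) xs \<and> length xs = l}"
  have "((\<lambda>(k, xs). q ^ (k * Suc l) * q ^ sum_list xs) has_sum 1 / (1 - q ^ Suc l) * (1 / qpoch q q l)) (UNIV \<times> ?D l)"
    by (intro has_sum_product_real Suc.IH geometric_has_sum q) simp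
  also have "?this \<longleftrightarrow> ((\<lambda>xs. q ^ sum_list xs) has_sum 1 / qpoch q q (Suc l)) (?D (Suc l))"
  proof (rule has_sum_reindex_bij_witness [of _ "\<lambda>ys. (last ys, map (\<lambda>y. y - last ys) (butlast ys))"
        "\<lambda>(k, xs). map (\<lambda>x. x + k) xs @ [k]"], goal_cases)
    case (1 kx)
    then show ?case by (auto simp: o_def)
  next
    case (2 kx)
    then show ?case by (auto simp: sorted_wrt_append sorted_wrt_map)
  next
    case (3 ys)
    then have ne: "ys \<noteq> []" by auto
    with 3 have ys: "sorted_wrt (\<ge>) (butlast ys @ [last ys])" by simp
    from ys have "map (\<lambda>x. x - last ys + last ys) (butlast ys) = butlast ys"
      by (intro map_idI) (auto simp: sorted_wrt_append)
    then show ?case using ne by (simp add: o_def)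
  next
    case (4 ys)
    then have ne: "ys \<noteq> []" by auto
    with 4 have ys: "sorted_wrt (\<ge>) (butlast ys @ [last ys])" by simp
    from ys have "sorted_wrt (\<ge>) (butlast ys)" by (simp add: sorted_wrt_append)
    then have "sorted_wrt (\<ge>) (map (\<lambda>y. y - last ys) (butlast ys))"
      unfolding sorted_wrt_map by (rule sorted_wrt_mono_rel [rotated]) auto
    with 4 show ?case by simp
  next
    case (5 kx)
    have "sum_list (map (\<lambda>x. x + k) xs) = sum_list xs + k * length xs" for k and xs :: "nat list"
      by (induction xs) auto
    with 5 show ?case by (auto simp: power_add algebra_simps)
  next
    case 6
    show ?case by (simp add: qpoch_Suc)
  qed
  finally show ?case .
qed

definition odd_parts_from :: "nat \<Rightarrow> nat list set" where
  "odd_parts_from m =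
    {xs. is_partition xs \<and> length xs = 2 * m + 1 \<and> (\<forall>p\<in>set xs. odd p \<and> 2 * m + 1 \<le> p)}"

text \<open>Subtracting $2m + 1$ from the $2m + 1$ parts and halving leaves an arbitrary weakly decreasing
  list of natural numbers.\<close>

lemma has_sum_odd_parts_from:
  fixes q :: real
  assumes q: "0 < q" "q < 1"
  shows "((\<lambda>xs. q ^ sum_list xs) has_sum q ^ (2 * m + 1)\<^sup>2 / qpoch (q\<^sup>2) (q\<^sup>2) (2 * m + 1)) (odd_parts_from m)"
proof -
  let ?D = "{xs :: nat list. sorted_wrt (\<ge>) xs \<and> length xs = 2 * m + 1}"
  have Q: "0 < q\<^sup>2" "q\<^sup>2 < 1"
    using q by (auto simp: power_less_one_iff)
  have "((\<lambda>xs. q ^ (2 * m + 1)\<^sup>2 * (q\<^sup>2) ^ sum_list xs) has_sum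
      q ^ (2 * m + 1)\<^sup>2 * (1 / qpoch (q\<^sup>2) (q\<^sup>2) (2 * m + 1))) ?D"
    by (intro has_sum_cmult_right has_sum_decreasing_lists Q)
  also have "?this \<longleftrightarrow> ?thesis"
  proof (rule has_sum_reindex_bij_witness [of _ "map (\<lambda>p. (p - (2 * m + 1)) div 2)" "map (\<lambda>x. 2 * x + (2 * m + 1))"], goal_cases)
    case (1 xs)
    then show ?case by (simp add: o_def)
  next
    case (2 xs)
    then show ?case by (auto simp: odd_parts_from_def is_partition_def sorted_wrt_map)
  next
    case (3 ys)
    have "2 * ((p - (2 * m + 1)) div 2) + (2 * m + 1) = p" if "p \<in> set ys" for p
    proof -
      have "odd p" "2 * m + 1 \<le> p" using 3 that by (auto simp: odd_parts_from_def)
      then show ?thesis by presburger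
    qed
    then show ?case
      unfolding map_map o_def by (rule map_idI)
  next
    case (4 ys)
    then have "sorted_wrt (\<ge>) (map (\<lambda>p. (p - (2 * m + 1)) div 2) ys)"
      unfolding sorted_wrt_map odd_parts_from_def is_partition_def
      by (auto intro!: div_le_mono diff_le_mono elim!: sorted_wrt_mono_rel [rotated])
    with 4 show ?case by (simp add: odd_parts_from_def)
  next
    case (5 xs)
    have "sum_list (map (\<lambda>x. 2 * x + c) xs) = 2 * sum_list xs + c * length xs" for c and xs :: "nat list"
      by (induction xs) auto
    from this [of "2 * m + 1" xs] 5
    have e: "sum_list (map (\<lambda>x. 2 * x + (2 * m + 1)) xs) = (2 * m + 1)\<^sup>2 + 2 * sum_list xs"
      by (simp add: power2_eq_square)
    show ?case unfolding e power_add [of q "(2 * m + 1)\<^sup>2"] power_mult [of q 2] ..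
  next
    case 6
    show ?case by simp
  qed
  finally show ?thesis .
qed

definition few_odd_parts_below :: "nat \<Rightarrow> nat list set" where
  "few_odd_parts_below m =
    {xs. is_partition xs \<and> (\<forall>p\<in>set xs. odd p \<and> p < 2 * m + 1 \<and> count_list xs p \<le> 2)}"

lemma few_odd_parts_below_eq:
  "few_odd_parts_below m = parts_in ((\<lambda>i. 2 * i + 1) ` {..<m}) {0, 1, 2}"
proof -
  let ?B = "{p :: nat. odd p \<and> p < 2 * m + 1}"
  have B: "(\<lambda>i. 2 * i + 1) ` {..<m} = ?B"
    by (auto elim!: oddE)
  have two: "k \<le> 2 \<longleftrightarrow> k \<in> {0, 1, 2}" for k :: nat by auto
  have "(\<forall>p\<in>set xs. count_list xs p \<le> 2) \<longleftrightarrow> (\<forall>p\<in>?B. count_list xs p \<le> 2)" if "set xs \<subseteq> ?B" for xs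
  proof (intro iffI ballI)
    fix p assume "\<forall>p\<in>set xs. count_list xs p \<le> 2"
    then show "count_list xs p \<le> 2"
      by (cases "p \<in> set xs") (auto simp: count_notin)
  qed (use that in auto)
  then show ?thesis
    unfolding few_odd_parts_below_def parts_in_def B two [symmetric] by auto
qed

lemma has_sum_few_odd_parts_below:
  fixes y :: real
  shows "((\<lambda>xs. y ^ sum_list xs) has_sum (\<Prod>i<m. 1 + y ^ (2 * i + 1) + y ^ (4 * i + 2))) (few_odd_parts_below m)"
proof -
  have "((\<lambda>xs. y ^ sum_list xs) has_sum (\<Prod>a\<in>(\<lambda>i. 2 * i + 1) ` {..<m}. 1 + y ^ a + y ^ (2 * a))) (few_odd_parts_below m)"
    unfolding few_odd_parts_below_eq
    by (intro has_sum_parts_in has_sum_finiteI) auto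
  also have "(\<Prod>a\<in>(\<lambda>i. 2 * i + 1) ` {..<m}. 1 + y ^ a + y ^ (2 * a)) =
      (\<Prod>i<m. 1 + y ^ (2 * i + 1) + y ^ (4 * i + 2))"
    by (subst prod.reindex) (auto simp: inj_on_def)
  finally show ?thesis .
qed

text \<open>The largest weight uses each of $1, 3, \dots, 2m - 1$ twice. Together with the lower bound
  $(2m+1)^2$ for the positive parts it shows that every signed partition of the kind considered
  has a positive weight, so that the counting series has no terms with exponent at most 0.\<close>

lemma sum_list_few_odd_parts_below:
  assumes "xs \<in> few_odd_parts_below m"
  shows "sum_list xs \<le> 2 * m\<^sup>2"
proof -
  have sub: "set xs \<subseteq> (\<lambda>i. 2 * i + 1) ` {..<m}"
    using assms by (auto simp: few_odd_parts_below_eq parts_in_def)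
  have "sum_list xs = (\<Sum>x\<in>set xs. count_list xs x * x)"
    using sum_list_map_eq_sum_count [of "\<lambda>x. x" xs] by simp
  also have "\<dots> \<le> (\<Sum>x\<in>set xs. 2 * x)"
    using assms by (intro sum_mono mult_right_mono) (auto simp: few_odd_parts_below_def)
  also have "\<dots> \<le> (\<Sum>x\<in>(\<lambda>i. 2 * i + 1) ` {..<m}. 2 * x)"
    using sub by (intro sum_mono2) auto
  also have "\<dots> = (\<Sum>i<m. 2 * (2 * i + 1))"
    by (subst sum.reindex) (auto simp: inj_on_def)
  also have "\<dots> = 2 * m\<^sup>2"
    by (induction m) (auto simp: power2_eq_square algebra_simps)
  finally show ?thesis .
qed

lemma sum_list_odd_parts_from:
  assumes "xs \<in> odd_parts_from m"
  shows "(2 * m + 1)\<^sup>2 \<le> sum_list xs"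
  using length_mult_le_sum_list [of xs "2 * m + 1"] assms
  by (auto simp: odd_parts_from_def power2_eq_square)

text \<open>The component \<open>m\<close> is determined by the number $2m + 1$ of positive parts; keeping it as a
  first component makes the set a dependent sum, over which one can sum fibrewise.\<close>

definition signed_pairs :: "(nat \<times> nat list \<times> nat list) set" where
  "signed_pairs = (SIGMA m:UNIV. odd_parts_from m \<times> few_odd_parts_below m)"

lemma signed_pairs_weight:
  assumes "(m, xs, ys) \<in> signed_pairs"
  shows "sum_list ys < sum_list xs"
proof -
  have "sum_list ys \<le> 2 * m\<^sup>2" "(2 * m + 1)\<^sup>2 \<le> sum_list xs"
    using assms sum_list_few_odd_parts_below [of ys m] sum_list_odd_parts_from [of xs m]
    by (auto simp: signed_pairs_def)
  moreover have "2 * m\<^sup>2 < (2 * m + 1)\<^sup>2"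
    by (simp add: power2_eq_square algebra_simps)
  ultimately show ?thesis by linarith
qed

lemma bij_betw_restricted_signed_partitions:
  "bij_betw snd {x \<in> signed_pairs. (case x of (m, xs, ys) \<Rightarrow> sum_list xs - sum_list ys - 1) = n}
     (restricted_signed_partitions (n + 1))"
proof (rule bij_betwI [where g = "\<lambda>(xs, ys). (length xs div 2, xs, ys)"], goal_cases)
  case 1
  show ?case
  proof (intro funcsetI, clarify)
    fix m xs ys
    assume x: "(m, xs, ys) \<in> signed_pairs" and n: "n = sum_list xs - sum_list ys - 1"
    have "int (sum_list xs - sum_list ys - 1 + 1) = int (sum_list xs) - int (sum_list ys)"
      using signed_pairs_weight [OF x] by simp
    with x show "snd (m, xs, ys) \<in> restricted_signed_partitions (sum_list xs - sum_list ys - 1 + 1)"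
      by (simp add: signed_pairs_def odd_parts_from_def few_odd_parts_below_def
          restricted_signed_partitions_def signed_partition_of_def)
  qed
next
  case 2
  show ?case
    by (auto simp: signed_pairs_def odd_parts_from_def few_odd_parts_below_def
        restricted_signed_partitions_def signed_partition_of_def)
next
  case (3 x)
  then show ?case by (auto simp: signed_pairs_def odd_parts_from_def)
next
  case (4 y)
  then show ?case by (cases y) simp
qed

text \<open>Summed over the fibre of $m$, the weights give the $m$-th term of the series in
  \<open>cyclotomic_series_eq_product\<close>. The exponent there is $(2m+1)^2 - 2m^2 - 1 = 2m^2 + 4m$, where
  $2m^2$ is used to clear the negative powers of $q$ that come from the negative parts, and 1
  is the shift between $n$ and $n + 1$ in the theorem.\<close>

lemma restricted_signed_partitions_series:
  fixes q :: real
  assumes q: "0 < q" "q < 1"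
  shows "((\<lambda>n. real (card (restricted_signed_partitions (n + 1))) * q ^ n) has_sum
    1 / (\<Prod>r\<in>residues18. qpoch_inf (q ^ r) (q ^ 18))) UNIV"
proof -
  let ?L = "1 / (\<Prod>r\<in>residues18. qpoch_inf (q ^ r) (q ^ 18))"
  let ?T = "\<lambda>m. \<Prod>i<m. 1 + q ^ (2 * i + 1) + q ^ (4 * i + 2)"
  let ?w = "\<lambda>(m :: nat, xs, ys). sum_list xs - sum_list ys - 1"
  define f where "f = (\<lambda>(m :: nat, xs, ys). (1 / q) * (q ^ sum_list xs * (1 / q) ^ sum_list ys))"
  define g where "g = (\<lambda>m. q ^ (2 * m * m + 4 * m) * ?T m / qpoch (q\<^sup>2) (q\<^sup>2) (2 * m + 1))"
  have reflect: "(\<Prod>i<m. 1 + (1 / q) ^ (2 * i + 1) + (1 / q) ^ (4 * i + 2)) * q ^ (2 * m * m) = ?T m" for m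
  proof (induction m)
    case (Suc m)
    have "2 * Suc m * Suc m = 2 * m * m + (4 * m + 2)" by simp
    then have "(\<Prod>i<Suc m. 1 + (1 / q) ^ (2 * i + 1) + (1 / q) ^ (4 * i + 2)) * q ^ (2 * Suc m * Suc m) =
      ?T m * ((1 + (1 / q) ^ (2 * m + 1) + (1 / q) ^ (4 * m + 2)) * q ^ (4 * m + 2))"
      unfolding Suc.IH [symmetric] by (simp only: power_add prod.lessThan_Suc mult_ac)
    also have "(1 + (1 / q) ^ (2 * m + 1) + (1 / q) ^ (4 * m + 2)) * q ^ (4 * m + 2) =
      1 + q ^ (2 * m + 1) + q ^ (4 * m + 2)"
    proof -
      have "q ^ (4 * m + 2) = q ^ (2 * m + 1) * q ^ (2 * m + 1)"
        unfolding power_add [symmetric] by (rule arg_cong [of _ _ "power q"]) simp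
      then show ?thesis
        using q by (simp add: power_divide field_simps)
    qed
    finally show ?case by simp
  qed simp
  have fibre: "((\<lambda>xy. f (m, xy)) has_sum g m) (odd_parts_from m \<times> few_odd_parts_below m)" for m
  proof -
    let ?N = "\<Prod>i<m. 1 + (1 / q) ^ (2 * i + 1) + (1 / q) ^ (4 * i + 2)"
    let ?D = "qpoch (q\<^sup>2) (q\<^sup>2) (2 * m + 1)"
    have "((\<lambda>(xs, ys). q ^ sum_list xs * (1 / q) ^ sum_list ys) has_sum
       (q ^ (2 * m + 1)\<^sup>2 / ?D) * ?N) (odd_parts_from m \<times> few_odd_parts_below m)"
      by (intro has_sum_product_real has_sum_odd_parts_from has_sum_few_odd_parts_below q)
    then have "((\<lambda>xy. f (m, xy)) has_sum (1 / q) * ((q ^ (2 * m + 1)\<^sup>2 / ?D) * ?N))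
       (odd_parts_from m \<times> few_odd_parts_below m)"
      unfolding f_def case_prod_unfold fst_conv snd_conv by (rule has_sum_cmult_right)
    also have "q ^ (2 * m + 1)\<^sup>2 = q * (q ^ (2 * m * m + 4 * m) * q ^ (2 * m * m))"
      unfolding power_add [symmetric] power_Suc [symmetric]
      by (rule arg_cong [of _ _ "power q"]) (simp add: power2_eq_square algebra_simps)
    also have "(1 / q) * ((q * (q ^ (2 * m * m + 4 * m) * q ^ (2 * m * m)) / ?D) * ?N) = g m"
      unfolding g_def reflect [of m, symmetric] using q by simp
    finally show ?thesis .
  qed
  have g: "(g has_sum ?L) UNIV"
    using cyclotomic_series_eq_product [OF q] unfolding g_def .
  have f_nonneg: "0 \<le> f x" for x
    using q by (auto simp: f_def case_prod_unfold)
  have "(f has_sum ?L) signed_pairs"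
    unfolding signed_pairs_def
  proof (rule has_sum_SigmaI [OF fibre g])
    show "f summable_on (SIGMA m:UNIV. odd_parts_from m \<times> few_odd_parts_below m)"
      by (rule summable_on_SigmaI [OF fibre has_sum_imp_summable [OF g] f_nonneg])
  qed
  also have "?this \<longleftrightarrow> ((\<lambda>x. q ^ ?w x) has_sum ?L) signed_pairs"
  proof (rule has_sum_cong)
    fix x assume "x \<in> signed_pairs"
    moreover obtain m xs ys where x: "x = (m, xs, ys)" by (cases x)
    ultimately have less: "sum_list ys < sum_list xs"
      by (auto intro: signed_pairs_weight)
    have "sum_list xs = Suc (sum_list xs - sum_list ys - 1) + sum_list ys"
      using less by simp
    then have "q ^ sum_list xs = q * q ^ (sum_list xs - sum_list ys - 1) * q ^ sum_list ys"
      by (metis power_Suc power_add)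
    then show "f x = q ^ ?w x"
      unfolding f_def x prod.case using q by (simp add: power_divide)
  qed
  finally have "((\<lambda>n. real (card {x \<in> signed_pairs. ?w x = n}) * q ^ n) has_sum ?L) UNIV"
  proof (rule has_sum_weight_series)
    show "finite {x \<in> signed_pairs. ?w x = n}" for n
      using bij_betw_finite [OF bij_betw_restricted_signed_partitions] finite_restricted_signed_partitions
      by blast
  qed
  then show ?thesis
    unfolding bij_betw_same_card [OF bij_betw_restricted_signed_partitions] .
qed

section \<open>Comparison of the two sides\<close>

theorem theorem4p12:
  fixes n :: nat
  shows "card (restricted_signed_partitions (n + 1)) = card (restricted_partitions n)"
proof -
  have "(\<lambda>n. real (card (restricted_signed_partitions (n + 1)))) = (\<lambda>n. real (card (restricted_partitions n)))"
    by (rule power_series_unique [OF restricted_signed_partitions_series restricted_partitions_series])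
  then show ?thesis
    by (metis of_nat_eq_iff)
qed

end
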